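(* Let $g\in H^\infty(\mathbb{D})$ be such that $g(\mathbb{D})\cap\mathbb{D}=\varnothing$, $|g|>1$ almost everywhere on $\mathbb{T}$, and $\log(|g|-1)\in L^1(\mathbb{T})$. Then for every $k>0$ and every non-zero $f\in H^2(\mathbb{D})$, $\lim_{n\to\infty}n^{-k}\|(T_g^* )^nf\|=+\infty$.
   Context: $\mathbb{D}$ is the open unit disk, $\mathbb{T}$ the unit circle with normalized Lebesgue measure; $H^\infty$ functions are identified with their boundary values on $\mathbb{T}$. $H^2(\mathbb{D})\subseteq L^2(\mathbb{T})$; for $g\in L^\infty(\mathbb{T})$, $T_g=PM_g$ with $M_g$ multiplication by $g$ and $P$ the orthogonal projection of $L^2(\mathbb{T})$ onto $H^2(\mathbb{D})$; $T_g^*$ is the Hilbert space adjoint. *)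

theory Defs
  imports "HOL-Analysis.Analysis"
begin

text \<open>The unit circle T is parametrised by t in [0,1] via t |-> cis(2 pi t); the pulled-back
Lebesgue measure on [0,1] is the normalized Lebesgue measure on T. Functions on T are
represented as functions complex => complex (only their values on T matter).\<close>

definition circ :: "real \<Rightarrow> complex" where
  "circ t = cis (2 * pi * t)"

definition L2T :: "(complex \<Rightarrow> complex) \<Rightarrow> bool" where
  "L2T h \<longleftrightarrow> (\<lambda>t. h (circ t)) \<in> borel_measurable lborel \<and>
     set_integrable lborel {0..1} (\<lambda>t. (cmod (h (circ t)))\<^sup>2)"

definition L2norm :: "(complex \<Rightarrow> complex) \<Rightarrow> real" where
  "L2norm h = sqrt (LINT t:{0..1}|lborel. (cmod (h (circ t)))\<^sup>2)"

definition fcoeff :: "(complex \<Rightarrow> complex) \<Rightarrow> int \<Rightarrow> complex" where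
  "fcoeff h n = (LINT t:{0..1}|lborel. h (circ t) * cis (- 2 * pi * of_int n * t))"

definition H2 :: "(complex \<Rightarrow> complex) \<Rightarrow> bool" where
  "H2 h \<longleftrightarrow> L2T h \<and> (\<forall>n<0. fcoeff h n = 0)"

text \<open>H^infinity, identified with boundary values: essentially bounded functions in H^2.\<close>
definition Hinf :: "(complex \<Rightarrow> complex) \<Rightarrow> bool" where
  "Hinf h \<longleftrightarrow> H2 h \<and> (\<exists>C. AE t in lborel. t \<in> {0..1} \<longrightarrow> cmod (h (circ t)) \<le> C)"

definition disc_ext :: "(complex \<Rightarrow> complex) \<Rightarrow> complex \<Rightarrow> complex" where
  "disc_ext h z = (\<Sum>n. fcoeff h (int n) * z ^ n)"

text \<open>Orthogonal (Riesz) projection P of L^2(T) onto H^2 (a representative of the class).\<close>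
definition Proj :: "(complex \<Rightarrow> complex) \<Rightarrow> (complex \<Rightarrow> complex)" where
  "Proj h = (SOME p. H2 p \<and> (\<forall>n\<ge>0. fcoeff p n = fcoeff h n))"

text \<open>Adjoint of the Toeplitz operator T_g: T_g^* = T_{conj g} = P M_{conj g}.\<close>
definition Toeplitz_adj :: "(complex \<Rightarrow> complex) \<Rightarrow> (complex \<Rightarrow> complex) \<Rightarrow> (complex \<Rightarrow> complex)" where
  "Toeplitz_adj g f = Proj (\<lambda>z. cnj (g z) * f z)"

end

theory Submission
  imports Defs "HOL-Complex_Analysis.Complex_Analysis" "HOL-Probability.Probability"
begin

text \<open>
Put u = 1/g, which is holomorphic and bounded by 1 in the disc. If f_n = (T_g^*)^n f, then f is
recovered from f_n by T_{u^n}^*, so <f, h> = <f_n, u^n h> for every h in H^2 and hence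
|<f, h>| <= ||f_n|| ||u^n h||. The test functions are h = z^j exp(P) with P a polynomial such that
Re P <= 0 on the circle, P(0) is real and Re P is L^1-close to min(0, L + m log(1 - |u|)).
Since |u|^n (1 - |u|)^m <= (m/n)^m, this makes ||u^n h|| at most of order e^L (m/n)^m. On the other
hand ||h - z^j||^2 <= 2 - 2 exp(P(0)), and P(0) is the mean of Re P, which is close to 0 once L is
large because log(1 - |u|) is integrable. So if the j-th coefficient of f is non-zero, <f, h> stays
away from 0, and ||f_n|| grows at least like n^m for every m.

That u^n h is the boundary function of an element of H^2 is obtained from the dilations G(r z) of
the holomorphic extension G of g: they converge to g in L^2, and x -> 1/x is 1-Lipschitz
on |x| >= 1.
\<close>

section \<open>Square-integrable functions\<close>

text \<open>Multiplying log(1 - |u|) by m keeps it integrable, which is why a single hypothesis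
  yields every polynomial order. Adding L brings the mean of the truncated function close to 0, and
  cutting it off at 0 keeps |h| <= 1 on the circle; the price is the factor e^L. The order of the
  choices matters. The index j, the tolerance and then L are fixed by f, g and m, so that e^L can
  enter the final constant. The polynomial P is chosen anew for every n: its L^1-error is added to
  ||u^n h||^2 and has to be dominated by (e^L (m/n)^m)^2, which shrinks with n. In <f, h> = <f_n,
  u^n h> each application of the adjoint hides a projection. The boundary function g and its
  extension G are tied together by Fourier coefficients alone, so their comparison takes place in
  L^2. The bound |G| >= 1 makes 1/G(rz) holomorphic beyond the closed disc, and together with |g| >=
  1 on the circle it controls the difference of the inverses.\<close>

definition square_integrable :: "'a measure \<Rightarrow> ('a \<Rightarrow> complex) \<Rightarrow> bool" where
  "square_integrable M a \<longleftrightarrow> a \<in> borel_measurable M \<and> integrable M (\<lambda>x. (cmod (a x))\<^sup>2)"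

definition l2 :: "'a measure \<Rightarrow> ('a \<Rightarrow> complex) \<Rightarrow> real" where
  "l2 M a = sqrt (\<integral>x. (cmod (a x))\<^sup>2 \<partial>M)"

lemma l2_nonneg [simp]: "0 \<le> l2 M a"
  by (simp add: l2_def)

lemma l2_power2: "(l2 M a)\<^sup>2 = (\<integral>x. (cmod (a x))\<^sup>2 \<partial>M)"
  by (simp add: l2_def)

lemma square_integrable_measurable [measurable_dest]:
  "square_integrable M a \<Longrightarrow> a \<in> borel_measurable M"
  by (simp add: square_integrable_def)

lemma square_integrable_norm_mult:
  assumes "square_integrable M a" "square_integrable M b"
  shows "integrable M (\<lambda>x. cmod (a x) * cmod (b x))"
proof (rule Bochner_Integration.integrable_bound)
  show "integrable M (\<lambda>x. (cmod (a x))\<^sup>2 + (cmod (b x))\<^sup>2)"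
    using assms by (auto simp: square_integrable_def)
  show "(\<lambda>x. cmod (a x) * cmod (b x)) \<in> borel_measurable M"
    using assms[THEN square_integrable_measurable] by measurable
  have "x * y \<le> x\<^sup>2 + y\<^sup>2" if "0 \<le> x" "0 \<le> y" for x y :: real
    using sum_squares_bound[of x y] mult_nonneg_nonneg[OF that] by linarith
  then show "AE x in M. norm (cmod (a x) * cmod (b x)) \<le> norm ((cmod (a x))\<^sup>2 + (cmod (b x))\<^sup>2)"
    by auto
qed

lemma square_integrable_mult:
  assumes "square_integrable M a" "square_integrable M b"
  shows "integrable M (\<lambda>x. a x * b x)"
  by (rule Bochner_Integration.integrable_bound[OF square_integrable_norm_mult[OF assms]])
     (use assms[THEN square_integrable_measurable] in \<open>auto simp: norm_mult\<close>)

lemma square_integrable_AE_le: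
  assumes b: "square_integrable M b" and a [measurable]: "a \<in> borel_measurable M"
    and le: "AE x in M. cmod (a x) \<le> C * cmod (b x)"
  shows "square_integrable M a"
  unfolding square_integrable_def
proof (intro conjI a, rule Bochner_Integration.integrable_bound)
  show "integrable M (\<lambda>x. C\<^sup>2 * (cmod (b x))\<^sup>2)"
    using b by (auto simp: square_integrable_def)
  show "AE x in M. norm ((cmod (a x))\<^sup>2) \<le> norm (C\<^sup>2 * (cmod (b x))\<^sup>2)"
    using le by eventually_elim (force dest: power_mono[where n=2] simp: power_mult_distrib)
qed measurable

lemma l2_AE_le:
  assumes b: "square_integrable M b" and a [measurable]: "a \<in> borel_measurable M"
    and C: "0 \<le> C" and le: "AE x in M. cmod (a x) \<le> C * cmod (b x)"
  shows "l2 M a \<le> C * l2 M b"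
proof -
  have "(\<integral>x. (cmod (a x))\<^sup>2 \<partial>M) \<le> (\<integral>x. C\<^sup>2 * (cmod (b x))\<^sup>2 \<partial>M)"
  proof (rule integral_mono_AE)
    show "integrable M (\<lambda>x. (cmod (a x))\<^sup>2)"
      using square_integrable_AE_le[OF b a le] by (simp add: square_integrable_def)
    show "integrable M (\<lambda>x. C\<^sup>2 * (cmod (b x))\<^sup>2)"
      using b by (auto simp: square_integrable_def)
    show "AE x in M. (cmod (a x))\<^sup>2 \<le> C\<^sup>2 * (cmod (b x))\<^sup>2"
      using le by eventually_elim (force dest: power_mono[where n=2] simp: power_mult_distrib)
  qed
  also have "\<dots> = (C * l2 M b)\<^sup>2"
    by (simp add: power_mult_distrib l2_power2)
  finally have "(l2 M a)\<^sup>2 \<le> (C * l2 M b)\<^sup>2"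
    by (simp add: l2_power2)
  then show ?thesis
    using C by (simp add: abs_le_square_iff[symmetric])
qed

lemma square_integrable_add:
  assumes a: "square_integrable M a" and b: "square_integrable M b"
  shows "square_integrable M (\<lambda>x. a x + b x)"
  unfolding square_integrable_def
proof (rule conjI[OF _ Bochner_Integration.integrable_bound])
  have [measurable]: "a \<in> borel_measurable M" "b \<in> borel_measurable M"
    using a b by (auto simp: square_integrable_def)
  show "(\<lambda>x. a x + b x) \<in> borel_measurable M"
    and "(\<lambda>x. (cmod (a x + b x))\<^sup>2) \<in> borel_measurable M"
    by measurable
  show "integrable M (\<lambda>x. 2 * (cmod (a x))\<^sup>2 + 2 * (cmod (b x))\<^sup>2)"
    using a b by (auto simp: square_integrable_def)
  have "(cmod (x + y))\<^sup>2 \<le> 2 * (cmod x)\<^sup>2 + 2 * (cmod y)\<^sup>2" for x y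
  proof -
    have "(cmod (x + y))\<^sup>2 \<le> (cmod x + cmod y)\<^sup>2"
      by (intro power_mono norm_triangle_ineq) auto
    also have "\<dots> \<le> 2 * (cmod x)\<^sup>2 + 2 * (cmod y)\<^sup>2"
      using sum_squares_bound[of "cmod x" "cmod y"] by (simp add: power2_sum)
    finally show ?thesis .
  qed
  then show "AE x in M. norm ((cmod (a x + b x))\<^sup>2)
      \<le> norm (2 * (cmod (a x))\<^sup>2 + 2 * (cmod (b x))\<^sup>2)"
    by auto
qed

lemma square_integrable_cmult:
  "square_integrable M a \<Longrightarrow> square_integrable M (\<lambda>x. c * a x)"
  by (rule square_integrable_AE_le[where b=a and C="cmod c"])
     (auto simp: norm_mult square_integrable_def)

lemma square_integrable_cnj [simp]:
  "square_integrable M (\<lambda>x. cnj (a x)) \<longleftrightarrow> square_integrable M a"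
proof -
  have *: "(\<lambda>x. cnj (a x)) \<in> borel_measurable M" if "a \<in> borel_measurable M" for a
    using measurable_compose[OF that borel_measurable_continuous_onI[of cnj]]
    by simp
  have "(\<lambda>x. cnj (a x)) \<in> borel_measurable M \<longleftrightarrow> a \<in> borel_measurable M"
    using *[of a] *[of "\<lambda>x. cnj (a x)"] unfolding complex_cnj_cnj by iprover
  then show ?thesis
    by (simp add: square_integrable_def)
qed

lemma l2_cnj [simp]: "l2 M (\<lambda>x. cnj (a x)) = l2 M a"
  by (simp add: l2_def)

lemma square_integrable_diff:
  assumes "square_integrable M a" "square_integrable M b"
  shows "square_integrable M (\<lambda>x. a x - b x)"
  using square_integrable_add[OF assms(1) square_integrable_cmult[OF assms(2), of "-1"]] by simp

lemma square_integrable_sum: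
  assumes "\<And>i. i \<in> I \<Longrightarrow> square_integrable M (a i)"
  shows "square_integrable M (\<lambda>x. \<Sum>i\<in>I. a i x)"
proof -
  have "square_integrable M (\<lambda>x. 0)" by (simp add: square_integrable_def)
  then show ?thesis using assms
    by (induction I rule: infinite_finite_induct) (auto intro: square_integrable_add)
qed

lemma square_integrable_bounded_mult:
  assumes "square_integrable M a" "b \<in> borel_measurable M" "AE x in M. cmod (b x) \<le> C"
  shows "square_integrable M (\<lambda>x. b x * a x)"
proof (rule square_integrable_AE_le[OF assms(1)])
  show "(\<lambda>x. b x * a x) \<in> borel_measurable M"
    using assms(2) square_integrable_measurable[OF assms(1)] by measurable
  show "AE x in M. cmod (b x * a x) \<le> C * cmod (a x)"
    using assms(3) by eventually_elim (simp add: norm_mult mult_right_mono)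
qed

lemma (in finite_measure) square_integrable_bounded:
  assumes "b \<in> borel_measurable M" "AE x in M. cmod (b x) \<le> C"
  shows "square_integrable M b"
  using square_integrable_bounded_mult[OF _ assms, of "\<lambda>_. 1"]
  by (simp add: square_integrable_def)

text \<open>The quadratic that maps s to the integral of (s |a| - |b|)^2 is nonnegative; its value
  at the minimiser s = I/A gives I^2 <= A B. The version with absolute values inside the integral is
  the one that \<open>l2_triangle\<close> needs.\<close>

lemma l2_Cauchy_Schwarz_norm:
  assumes a: "square_integrable M a" and b: "square_integrable M b"
  shows "(\<integral>x. cmod (a x) * cmod (b x) \<partial>M) \<le> l2 M a * l2 M b"
proof -
  define A B I where "A = (\<integral>x. (cmod (a x))\<^sup>2 \<partial>M)" and "B = (\<integral>x. (cmod (b x))\<^sup>2 \<partial>M)"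
    and "I = (\<integral>x. cmod (a x) * cmod (b x) \<partial>M)"
  have [measurable]: "a \<in> borel_measurable M" "b \<in> borel_measurable M"
    using a b by (auto simp: square_integrable_def)
  have ge: "0 \<le> s\<^sup>2 * A - 2 * s * I + B" for s
  proof -
    have "0 \<le> (\<integral>x. (s * cmod (a x) - cmod (b x))\<^sup>2 \<partial>M)"
      by simp
    also have "\<dots> = (\<integral>x. s\<^sup>2 * (cmod (a x))\<^sup>2 - 2 * s * (cmod (a x) * cmod (b x)) + (cmod (b x))\<^sup>2 \<partial>M)"
      by (simp add: power2_diff power_mult_distrib algebra_simps)
    also have "\<dots> = s\<^sup>2 * A - 2 * s * I + B"
      using a b square_integrable_norm_mult[OF a b]
      by (simp add: A_def B_def I_def square_integrable_def)
    finally show ?thesis .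
  qed
  have "A \<ge> 0" "B \<ge> 0" "I \<ge> 0" by (auto simp: A_def B_def I_def)
  have "I\<^sup>2 \<le> A * B"
  proof (cases "A = 0")
    case True
    \<comment> \<open>For A = 0 the quadratic degenerates to B - 2 s I; if I were non-zero, the
      chosen s would give it the value -1.\<close>
    have "I = 0"
      using ge[of "(B + 1) / (2 * I)"] True by (cases "I = 0") auto
    then show ?thesis using True by simp
  next
    case False
    then have "A > 0" using \<open>A \<ge> 0\<close> by simp
    have "0 \<le> A * ((I/A)\<^sup>2 * A - 2 * (I/A) * I + B)"
      using ge[of "I/A"] \<open>A > 0\<close> by simp
    also have "\<dots> = A * B - I\<^sup>2"
      using \<open>A > 0\<close> by (simp add: field_simps power2_eq_square)
    finally show ?thesis by simp
  qed
  then have "I \<le> sqrt (A * B)"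
    by (rule real_le_rsqrt)
  then show ?thesis
    by (simp add: l2_def A_def B_def I_def real_sqrt_mult)
qed

lemma l2_Cauchy_Schwarz:
  assumes a: "square_integrable M a" and b: "square_integrable M b"
  shows "cmod (\<integral>x. a x * b x \<partial>M) \<le> l2 M a * l2 M b"
proof -
  have "cmod (\<integral>x. a x * b x \<partial>M) \<le> (\<integral>x. cmod (a x * b x) \<partial>M)"
    by (rule integral_norm_bound)
  also have "\<dots> \<le> l2 M a * l2 M b"
    using l2_Cauchy_Schwarz_norm[OF a b] by (simp add: norm_mult)
  finally show ?thesis .
qed

lemma l2_triangle:
  assumes a: "square_integrable M a" and b: "square_integrable M b"
  shows "l2 M (\<lambda>x. a x + b x) \<le> l2 M a + l2 M b"
proof -
  have ab: "square_integrable M (\<lambda>x. a x + b x)"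
    by (rule square_integrable_add[OF a b])
  have "(l2 M (\<lambda>x. a x + b x))\<^sup>2
      \<le> (\<integral>x. (cmod (a x))\<^sup>2 + 2 * (cmod (a x) * cmod (b x)) + (cmod (b x))\<^sup>2 \<partial>M)"
    unfolding l2_power2
  proof (rule integral_mono)
    show "integrable M (\<lambda>x. (cmod (a x + b x))\<^sup>2)"
      using ab by (simp add: square_integrable_def)
    show "integrable M (\<lambda>x. (cmod (a x))\<^sup>2 + 2 * (cmod (a x) * cmod (b x)) + (cmod (b x))\<^sup>2)"
      using a b square_integrable_norm_mult[OF a b] by (auto simp: square_integrable_def)
    fix x
    have "(cmod (a x + b x))\<^sup>2 \<le> (cmod (a x) + cmod (b x))\<^sup>2"
      by (intro power_mono norm_triangle_ineq) auto
    then show "(cmod (a x + b x))\<^sup>2 \<le> (cmod (a x))\<^sup>2 + 2 * (cmod (a x) * cmod (b x)) + (cmod (b x))\<^sup>2"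
      by (simp add: power2_sum algebra_simps)
  qed
  also have "\<dots> = (l2 M a)\<^sup>2 + 2 * (\<integral>x. cmod (a x) * cmod (b x) \<partial>M) + (l2 M b)\<^sup>2"
    using a b square_integrable_norm_mult[OF a b] by (simp add: l2_power2 square_integrable_def)
  also have "\<dots> \<le> (l2 M a + l2 M b)\<^sup>2"
    using l2_Cauchy_Schwarz_norm[OF a b] by (simp add: power2_sum)
  finally show ?thesis
    by (rule power2_le_imp_le) simp
qed

lemma (in prob_space) l2_bounded:
  assumes "b \<in> borel_measurable M" "AE x in M. cmod (b x) \<le> C" "0 \<le> C"
  shows "l2 M b \<le> C"
  using l2_AE_le[of M "\<lambda>_. 1" b C] assms by (simp add: square_integrable_def l2_def prob_space)

section \<open>Fourier coefficients on the circle\<close>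

text \<open>Set integrals over [0,1] become integrals over a probability space, to which the results
  on \<open>square_integrable\<close> apply directly.\<close>

abbreviation UI :: "real measure" where
  "UI \<equiv> restrict_space lborel {0..1}"

lemma space_UI [simp]: "space UI = {0..1}"
  by (simp add: space_restrict_space)

interpretation UI: prob_space UI
proof
  show "emeasure UI (space UI) = 1"
    by (simp add: emeasure_restrict_space)
qed

lemma cmod_circ [simp]: "cmod (circ t) = 1"
  by (simp add: circ_def)

lemma circ_mult_cnj [simp]: "circ t * cnj (circ t) = 1"
  by (simp add: circ_def cis_cnj cis_mult)

lemma continuous_on_circ [continuous_intros]: "continuous_on S circ"
  unfolding circ_def by (intro continuous_intros)

lemma measurable_circ [measurable]: "circ \<in> borel_measurable borel"
  by (intro borel_measurable_continuous_onI continuous_intros)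

lemma measurable_circ_UI [measurable]: "circ \<in> borel_measurable UI"
  by (rule measurable_restrict_space1) simp

lemma measurable_compose_circ:
  assumes "continuous_on (sphere 0 1) F"
  shows "(\<lambda>t. F (circ t)) \<in> borel_measurable borel"
  by (rule borel_measurable_continuous_onI, rule continuous_on_compose2[OF assms])
     (auto intro: continuous_intros)

lemma measurable_compose_circ_UI:
  assumes "continuous_on (sphere 0 1) F"
  shows "(\<lambda>t. F (circ t)) \<in> borel_measurable UI"
  by (rule measurable_restrict_space1) (simp add: measurable_compose_circ[OF assms])

lemma continuous_circle_bounded:
  assumes "continuous_on (sphere 0 1) F"
  obtains B where "B > 0" "\<And>z. cmod z = 1 \<Longrightarrow> cmod (F z) \<le> B"
proof -
  have "bounded (F ` sphere 0 1)"
    by (intro compact_imp_bounded compact_continuous_image assms) simp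
  then show ?thesis
    using that by (auto simp: bounded_pos)
qed

lemma square_integrable_circ:
  assumes "continuous_on (sphere 0 1) F"
  shows "square_integrable UI (\<lambda>t. F (circ t))"
proof -
  obtain B where "\<And>z. cmod z = 1 \<Longrightarrow> cmod (F z) \<le> B"
    using continuous_circle_bounded[OF assms] by blast
  then show ?thesis
    by (intro UI.square_integrable_bounded[where C=B] measurable_compose_circ_UI assms) auto
qed

lemma square_integrable_circ_power [simp]: "square_integrable UI (\<lambda>t. circ t ^ n)"
  by (rule square_integrable_circ) (intro continuous_intros)

lemma square_integrable_poly_circ [simp]: "square_integrable UI (\<lambda>t. poly P (circ t))"
  by (rule square_integrable_circ) (intro continuous_intros)

lemma integrable_circ:
  assumes "continuous_on (sphere 0 1) F"
  shows "integrable UI (\<lambda>t. F (circ t) :: complex)"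
  using square_integrable_mult[OF square_integrable_circ[OF assms], of "\<lambda>_. 1"]
  by (simp add: square_integrable_def)

lemma circ_power: "circ t ^ n = cis (2 * pi * real n * t)"
  using Complex.DeMoivre[of "2 * pi * t" n] by (simp add: circ_def mult_ac)

section \<open>Orthogonality of the powers of \<open>circ\<close>, Parseval for finite sums and
  Bessel's inequality\<close>

lemma integral_circ_power: "(\<integral>t. circ t ^ n \<partial>UI) = (if n = 0 then 1 else 0)"
proof (cases "n = 0")
  case True
  then show ?thesis by (simp add: UI.prob_space[simplified])
next
  case False
  define F where "F t = cis (2 * pi * real n * t) / (2 * pi * real n * \<i>)" for t
  have "(\<integral>t. circ t ^ n \<partial>UI) = (\<integral>t. indicator {0..1} t *\<^sub>R circ t ^ n \<partial>lborel)"
    by (simp add: integral_restrict_space)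
  also have "\<dots> = F 1 - F 0"
  proof (rule integral_FTC_Icc)
    show "continuous_on {0..1} (\<lambda>t. circ t ^ n)"
      by (intro continuous_intros)
    fix t :: real
    define c where "c = 2 * pi * real n * \<i>"
    have c: "c \<noteq> 0" using False by (simp add: c_def)
    have cis: "cis (2 * pi * real n * t) = exp (of_real t * c)" for t
      by (simp add: cis_conv_exp c_def mult_ac)
    have "((\<lambda>t. exp (of_real t * c) / c) has_vector_derivative exp (of_real t * c)) (at t within {0..1})"
      by (rule has_vector_derivative_real_field) (use c in \<open>auto intro!: derivative_eq_intros\<close>)
    then show "(F has_vector_derivative circ t ^ n) (at t within {0..1})"
      unfolding F_def[abs_def] circ_power cis c_def[symmetric] .
  qed simp
  also have "F 1 - F 0 = 0"
    using cis_multiple_2pi[of "real n"] by (simp add: F_def)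
  finally show ?thesis using False by simp
qed

lemma integral_circ_power_cnj:
  "(\<integral>t. circ t ^ i * cnj (circ t ^ j) \<partial>UI) = (if i = j then 1 else 0)"
proof (cases "j \<le> i")
  case True
  then have "circ t ^ i * cnj (circ t ^ j) = circ t ^ (i - j)" for t
    using power_add[of "circ t" "i - j" j] by (simp add: mult.assoc flip: power_mult_distrib)
  then show ?thesis using True by (simp add: integral_circ_power del: complex_cnj_power)
next
  case False
  then have "circ t ^ i * cnj (circ t ^ j) = cnj (circ t ^ (j - i))" for t
    using power_add[of "cnj (circ t)" i "j - i"]
    by (simp flip: power_mult_distrib mult.assoc)
  then show ?thesis using False by (simp add: integral_circ_power del: complex_cnj_power)
qed

lemma integral_poly_circ: "(\<integral>t. poly P (circ t) \<partial>UI) = poly P 0"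
proof -
  have "(\<integral>t. poly P (circ t) \<partial>UI) = (\<integral>t. (\<Sum>i\<le>degree P. coeff P i * circ t ^ i) \<partial>UI)"
    by (simp add: poly_altdef)
  also have "\<dots> = (\<Sum>i\<le>degree P. coeff P i * (\<integral>t. circ t ^ i \<partial>UI))"
    by (subst Bochner_Integration.integral_sum)
       (auto intro!: integrable_circ continuous_intros)
  also have "\<dots> = poly P 0"
    by (simp add: integral_circ_power poly_0_coeff_0 if_distrib cong: if_cong)
  finally show ?thesis .
qed

lemma integral_cnj_poly_eq_0:
  assumes q: "square_integrable UI q" and 0: "\<And>n. (\<integral>t. q t * cnj (circ t ^ n) \<partial>UI) = 0"
  shows "(\<integral>t. q t * cnj (poly P (circ t)) \<partial>UI) = 0"
proof -
  have i: "integrable UI (\<lambda>t. q t * cnj (circ t ^ n))" for n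
    by (intro square_integrable_mult q) (simp del: complex_cnj_power)
  have "(\<integral>t. q t * cnj (poly P (circ t)) \<partial>UI)
      = (\<integral>t. (\<Sum>i\<le>degree P. cnj (coeff P i) * (q t * cnj (circ t ^ i))) \<partial>UI)"
    by (simp add: poly_altdef sum_distrib_left mult_ac)
  also have "\<dots> = (\<Sum>i\<le>degree P. cnj (coeff P i) * (\<integral>t. q t * cnj (circ t ^ i) \<partial>UI))"
    using i by (subst Bochner_Integration.integral_sum) (auto simp del: complex_cnj_power)
  finally show ?thesis using 0 by simp
qed

lemma integral_norm_power2:
  "complex_of_real ((l2 M a)\<^sup>2) = (\<integral>x. a x * cnj (a x) \<partial>M)"
  unfolding l2_power2 complex_norm_square[symmetric] of_real_power[symmetric]
  by (rule integral_complex_of_real[symmetric])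

lemma square_integrable_trig_sum [simp]:
  "square_integrable UI (\<lambda>t. \<Sum>n\<in>A. c n * circ t ^ n)"
  by (intro square_integrable_sum square_integrable_cmult) simp

lemma l2_trig_sum:
  assumes "finite A"
  shows "(l2 UI (\<lambda>t. \<Sum>n\<in>A. c n * circ t ^ n))\<^sup>2 = (\<Sum>n\<in>A. (cmod (c n))\<^sup>2)"
proof -
  have i: "integrable UI (\<lambda>t. circ t ^ i * cnj (circ t ^ j))" for i j
    by (intro square_integrable_mult) (simp_all del: complex_cnj_power)
  have "complex_of_real ((l2 UI (\<lambda>t. \<Sum>n\<in>A. c n * circ t ^ n))\<^sup>2)
     = (\<integral>t. (\<Sum>i\<in>A. \<Sum>j\<in>A. c i * cnj (c j) * (circ t ^ i * cnj (circ t ^ j))) \<partial>UI)"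
    unfolding integral_norm_power2 by (simp add: sum_product mult_ac)
  also have "\<dots> = (\<Sum>i\<in>A. \<Sum>j\<in>A. c i * cnj (c j) * (\<integral>t. circ t ^ i * cnj (circ t ^ j) \<partial>UI))"
    using i by (subst Bochner_Integration.integral_sum, simp del: complex_cnj_power)+
               (simp del: complex_cnj_power)
  also have "\<dots> = of_real (\<Sum>n\<in>A. (cmod (c n))\<^sup>2)"
    using assms by (simp add: integral_circ_power_cnj if_distrib complex_norm_square[unfolded of_real_power] del: complex_cnj_power cong: if_cong)
  finally show ?thesis unfolding of_real_eq_iff .
qed

text \<open>S is the orthogonal projection of q onto the span of the chosen powers, so <q, S> =
  ||S||^2. Cauchy-Schwarz and cancelling one factor ||S|| give ||S|| <= ||q||, and
  \<open>l2_trig_sum\<close> evaluates ||S||.\<close>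

lemma Bessel_inequality:
  assumes q: "square_integrable UI q" and A: "finite A"
  shows "(\<Sum>n\<in>A. (cmod (\<integral>t. q t * cnj (circ t ^ n) \<partial>UI))\<^sup>2) \<le> (l2 UI q)\<^sup>2"
proof -
  define c where "c n = (\<integral>t. q t * cnj (circ t ^ n) \<partial>UI)" for n
  define S where "S t = (\<Sum>n\<in>A. c n * circ t ^ n)" for t
  have S: "square_integrable UI S" unfolding S_def by simp
  have i: "integrable UI (\<lambda>t. q t * cnj (circ t ^ n))" for n
    by (intro square_integrable_mult q) (simp del: complex_cnj_power)
  have "(\<integral>t. q t * cnj (S t) \<partial>UI) = (\<integral>t. (\<Sum>n\<in>A. cnj (c n) * (q t * cnj (circ t ^ n))) \<partial>UI)"
    by (simp add: S_def sum_distrib_left mult_ac)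
  also have "\<dots> = (\<Sum>n\<in>A. cnj (c n) * c n)"
    using i by (subst Bochner_Integration.integral_sum) (auto simp: c_def simp del: complex_cnj_power)
  also have "\<dots> = of_real (\<Sum>n\<in>A. (cmod (c n))\<^sup>2)"
    by (simp add: complex_norm_square[unfolded of_real_power] mult.commute)
  also have "\<dots> = of_real ((l2 UI S)\<^sup>2)"
    unfolding S_def by (simp add: l2_trig_sum[OF A])
  finally have eq: "(\<integral>t. q t * cnj (S t) \<partial>UI) = of_real ((l2 UI S)\<^sup>2)" .
  have "l2 UI S * l2 UI S = cmod (\<integral>t. q t * cnj (S t) \<partial>UI)"
    unfolding eq norm_of_real by (simp add: power2_eq_square)
  also have "\<dots> \<le> l2 UI q * l2 UI S"
    using l2_Cauchy_Schwarz[of UI q "\<lambda>t. cnj (S t)"] q S by simp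
  finally have "l2 UI S \<le> l2 UI q"
    by (cases "l2 UI S = 0") (auto simp: mult_le_cancel_right less_le)
  then have "(l2 UI S)\<^sup>2 \<le> (l2 UI q)\<^sup>2" by (intro power_mono) auto
  then show ?thesis
    unfolding S_def l2_trig_sum[OF A] c_def .
qed

text \<open>Split off the constant coefficient of both factors. On the circle the product of z P and
  conj(z Q) is P conj(Q) again, which is the induction hypothesis, and the remaining terms are
  analytic or conjugate analytic, hence have the real part of a polynomial.\<close>

lemma Re_poly_mult_cnj_poly:
  "\<exists>S. \<forall>z. cmod z = 1 \<longrightarrow> Re (poly P z * cnj (poly Q z)) = Re (poly S z)"
proof (induction P Q rule: poly_induct2)
  case 0
  show ?case by (intro exI[of _ 0]) simp
next
  case (pCons a P b Q)
  then obtain S where S: "\<And>z. cmod z = 1 \<Longrightarrow> Re (poly P z * cnj (poly Q z)) = Re (poly S z)"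
    by blast
  \<comment> \<open>The first summand comes from a conj(b + z Q), since Re(a conj(w)) = Re(conj(a)
    w); the second is conj(b) z P.\<close>
  define R where "R = smult (cnj a) (pCons b Q) + smult (cnj b) (pCons 0 P) + S"
  have "Re (poly (pCons a P) z * cnj (poly (pCons b Q) z)) = Re (poly R z)" if z: "cmod z = 1" for z
  proof -
    have zz: "z * cnj z = 1"
      using z complex_norm_square[of z] by simp
    have "poly (pCons a P) z * cnj (poly (pCons b Q) z)
      = cnj (cnj a * poly (pCons b Q) z) + cnj b * poly (pCons 0 P) z
        + (z * cnj z) * (poly P z * cnj (poly Q z))"
      by (simp add: algebra_simps)
    then have "Re (poly (pCons a P) z * cnj (poly (pCons b Q) z))
      = Re (cnj a * poly (pCons b Q) z) + Re (cnj b * poly (pCons 0 P) z) + Re (poly S z)"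
      unfolding zz by (simp only: plus_complex.simps complex_cnj mult_1 S[OF z] cnj.simps)
    then show ?thesis unfolding R_def poly_add poly_smult plus_complex.simps .
  qed
  then show ?case by blast
qed

text \<open>Brings the real polynomials of Stone-Weierstrass into the analytic form to which the
  mean value property and \<open>exp\<close> apply. Products are covered by Re p Re q = (Re(p q) +
  Re(p conj(q))) / 2.\<close>

lemma real_polynomial_function_circle:
  assumes "real_polynomial_function p"
  shows "\<exists>P. \<forall>z::complex. cmod z = 1 \<longrightarrow> p z = Re (poly P z)"
  using assms
proof (induction rule: real_polynomial_function.induct)
  case (linear f)
  interpret bounded_linear f by fact
  \<comment> \<open>A real-linear f is x f(1) + y f(i), which is the real part of (f(1) - i f(i)) (x
    + i y).\<close>
  have "f z = Re (poly [:0, Complex (f 1) (- f \<i>):] z)" for z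
  proof -
    have "f z = f (Re z *\<^sub>R 1 + Im z *\<^sub>R \<i>)"
      by (rule arg_cong[where f=f]) (simp add: complex_eq_iff)
    also have "\<dots> = Re z * f 1 + Im z * f \<i>"
      by (simp only: add scaleR real_scaleR_def)
    finally show ?thesis by simp
  qed
  then show ?case by blast
next
  case (const c)
  show ?case by (intro exI[of _ "[:of_real c:]"]) simp
next
  case (add p q)
  then obtain P Q where "\<And>z. cmod z = 1 \<Longrightarrow> p z = Re (poly P z)" "\<And>z. cmod z = 1 \<Longrightarrow> q z = Re (poly Q z)"
    by blast
  then show ?case by (intro exI[of _ "P + Q"]) simp
next
  case (mult p q)
  then obtain P Q where PQ: "\<And>z. cmod z = 1 \<Longrightarrow> p z = Re (poly P z)"
      "\<And>z. cmod z = 1 \<Longrightarrow> q z = Re (poly Q z)"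
    by blast
  obtain S where S: "\<And>z. cmod z = 1 \<Longrightarrow> Re (poly P z * cnj (poly Q z)) = Re (poly S z)"
    using Re_poly_mult_cnj_poly by blast
  have "p z * q z = Re (poly (smult (1/2) (P * Q + S)) z)" if z: "cmod z = 1" for z
  proof -
    have "p z * q z = (Re (poly P z * poly Q z) + Re (poly P z * cnj (poly Q z))) / 2"
      by (simp add: PQ[OF z])
    also have "\<dots> = Re (poly (smult (1/2) (P * Q + S)) z)"
      by (simp add: S[OF z] del: cnj.simps times_complex.sel)
    finally show ?thesis .
  qed
  then show ?case by blast
qed

section \<open>Density of trigonometric polynomials\<close>

text \<open>\<open>Arg2pi\<close> jumps at 1, so continuity of H cannot be read off its formula. But
  the preimage under H of a closed set is the image under \<open>circ\<close> of a compact subset of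
  [0,1], hence closed. The condition \<open>h 0 = h 1\<close> makes H agree with h at both
  ends.\<close>

lemma continuous_on_circle_factor:
  fixes h :: "real \<Rightarrow> real"
  assumes h: "continuous_on {0..1} h" and h01: "h 0 = h 1"
  obtains H where "continuous_on (sphere 0 1) H" "\<And>t. t \<in> {0..1} \<Longrightarrow> H (circ t) = h t"
proof -
  define H where "H z = h (Arg2pi z / (2 * pi))" for z
  have Hcirc: "H (circ t) = h t" if t: "t \<in> {0..1}" for t
  proof (cases "t = 1")
    case True
    have "circ 1 = 1" by (simp add: circ_def)
    moreover have "Arg2pi 1 = 0" by (simp add: Arg2pi_eq_0)
    ultimately show ?thesis using True h01 by (simp add: H_def)
  next
    case False
    have "Arg2pi (circ t) = 2 * pi * t"
      by (rule Arg2pi_unique[of 1]) (use t False in \<open>auto simp: circ_def cis_conv_exp\<close>)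
    then show ?thesis by (simp add: H_def)
  qed
  have surj: "\<exists>t\<in>{0..1}. z = circ t" if "cmod z = 1" for z
    using Arg2pi[of z] that
    by (intro bexI[of _ "Arg2pi z / (2 * pi)"]) (auto simp: circ_def cis_conv_exp is_Arg_def)
  have "closed (H -` B \<inter> sphere 0 1)" if "closed B" for B
  proof -
    have "H -` B \<inter> sphere 0 1 = circ ` (h -` B \<inter> {0..1})"
    proof (intro equalityI subsetI)
      fix z assume z: "z \<in> H -` B \<inter> sphere 0 1"
      then obtain t where "t \<in> {0..1}" "z = circ t"
        using surj[of z] by auto
      then show "z \<in> circ ` (h -` B \<inter> {0..1})"
        using z Hcirc[of t] by auto
    qed (use Hcirc in auto)
    moreover have "closed (h -` B \<inter> {0..1})"
      using h that by (simp add: continuous_on_closed_vimage)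
    then have "compact (h -` B \<inter> {0..1})"
      by (metis compact_Icc closed_Int_compact inf.idem inf_assoc)
    then have "compact (circ ` (h -` B \<inter> {0..1}))"
      by (intro compact_continuous_image continuous_intros)
    ultimately show ?thesis by (simp add: compact_imp_closed)
  qed
  then have "continuous_on (sphere 0 1) H"
    by (subst continuous_on_closed_vimage) auto
  with Hcirc show ?thesis by (intro that)
qed

text \<open>The bounds have to hold at every point of the circle, because Re P <= 0 is what later
  gives |exp P| <= 1. Therefore \<phi> is clipped to a slightly smaller interval, the clipped
  function is approximated in L^1 by continuous ones, and the uniform error of Stone-Weierstrass is
  absorbed by the margin that clipping left.\<close>

lemma trig_approx_real:
  fixes \<phi> :: "real \<Rightarrow> real"
  assumes meas: "\<phi> \<in> borel_measurable UI" and bd: "AE t in UI. a \<le> \<phi> t \<and> \<phi> t \<le> b"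
    and ab: "a < b" and \<delta>: "0 < \<delta>"
  shows "\<exists>P. (\<forall>z. cmod z = 1 \<longrightarrow> a \<le> Re (poly P z) \<and> Re (poly P z) \<le> b) \<and>
             (\<integral>t. \<bar>\<phi> t - Re (poly P (circ t))\<bar> \<partial>UI) \<le> \<delta>"
proof -
  define \<psi> where "\<psi> t = indicator {0..1} t * \<phi> t" for t
  have "\<psi> \<in> borel_measurable lborel"
    using meas borel_measurable_restrict_space_iff[of "{0..1}" lborel \<phi>] by (simp add: \<psi>_def[abs_def])
  then have "\<psi> \<in> borel_measurable lebesgue"
    by (rule measurable_completion)
  then have "\<psi> measurable_on UNIV"
    by (rule lebesgue_measurable_imp_measurable_on_real) simp
  then obtain N g where N: "negligible N" and g: "\<And>n. continuous_on UNIV (g n)"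
    and lim: "\<And>t. t \<notin> N \<Longrightarrow> (\<lambda>n. g n t) \<longlonglongrightarrow> \<psi> t"
    unfolding measurable_on_def by auto
  \<comment> \<open>A third of \<delta> for each of three errors: clipping, L^1-approximation and
    Stone-Weierstrass. A third of b - a keeps the clipping interval non-empty.\<close>
  define \<eta> where "\<eta> = min (\<delta> / 3) ((b - a) / 3)"
  have \<eta>: "0 < \<eta>" "\<eta> \<le> \<delta> / 3" "a + \<eta> \<le> b - \<eta>"
    using ab \<delta> by (auto simp: \<eta>_def min_def field_simps)
  define clip where "clip x = max (a + \<eta>) (min (b - \<eta>) x)" for x
  have clip: "a + \<eta> \<le> clip x" "clip x \<le> b - \<eta>" for x
    using \<eta> by (auto simp: clip_def)
  have clip_near: "\<bar>x - clip x\<bar> \<le> \<eta>" if "a \<le> x" "x \<le> b" for x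
    using that \<eta> by (auto simp: clip_def max_def min_def)
  have cont_clip: "continuous_on S clip" for S
    unfolding clip_def by (intro continuous_intros)
  \<comment> \<open>The tent factor vanishes at 0 and 1, so that h takes the same value
    \<open>clip 0\<close> there and descends to the circle; at each interior point it equals 1 for
    large n.\<close>
  define h where "h n t = clip (min 1 (real n * min t (1 - t)) * g n t)" for n t
  have cont_h: "continuous_on UNIV (h n)" for n
    unfolding h_def
    by (rule continuous_on_compose2[OF cont_clip[of UNIV]]) (intro continuous_intros g, simp)
  have [measurable]: "h n \<in> borel_measurable UI" "clip \<in> borel_measurable borel" for n
    by (auto intro!: measurable_restrict_space1 borel_measurable_continuous_onI cont_h cont_clip)
  note meas [measurable]
  have "AE t in lebesgue. t \<notin> N"
    using N by (intro AE_not_in) (simp add: negligible_iff_null_sets)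
  then have N': "AE t in lborel. t \<notin> N"
    by (simp add: AE_completion_iff)
  have "AE t in lborel. t \<noteq> (0::real)" "AE t in lborel. t \<noteq> (1::real)"
    using AE_lborel_singleton by auto
  with N' have "AE t in lborel. t \<in> {0..1} \<longrightarrow> (\<lambda>n. h n t) \<longlonglongrightarrow> clip (\<phi> t)"
  proof eventually_elim
    case (elim t)
    show ?case
    proof
      assume t: "t \<in> {0..1}"
      define s where "s = min t (1 - t)"
      have s: "s > 0" using t elim by (auto simp: s_def)
      have "eventually (\<lambda>n. min 1 (real n * s) = 1) sequentially"
      proof -
        have "filterlim (\<lambda>n. real n * s) at_top sequentially"
          using s by (intro filterlim_at_top_mult_tendsto_pos[OF tendsto_const] filterlim_real_sequentially)
        then have "eventually (\<lambda>n. real n * s \<ge> 1) sequentially"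
          by (simp add: filterlim_at_top)
        then show ?thesis by eventually_elim simp
      qed
      then have "(\<lambda>n. min 1 (real n * s)) \<longlonglongrightarrow> 1"
        by (rule tendsto_eventually)
      then have "(\<lambda>n. min 1 (real n * s) * g n t) \<longlonglongrightarrow> 1 * \<psi> t"
        using elim by (intro tendsto_mult lim) auto
      moreover have "isCont clip (\<psi> t)"
        using cont_clip[of UNIV] by (simp add: continuous_on_eq_continuous_at)
      ultimately have "(\<lambda>n. h n t) \<longlonglongrightarrow> clip (1 * \<psi> t)"
        unfolding h_def s_def[symmetric] mult_1 by (rule isCont_tendsto_compose[rotated])
      then show "(\<lambda>n. h n t) \<longlonglongrightarrow> clip (\<phi> t)"
        using t by (simp add: \<psi>_def)
    qed
  qed
  then have conv: "AE t in UI. (\<lambda>n. h n t) \<longlonglongrightarrow> clip (\<phi> t)"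
    by (simp add: AE_restrict_space_iff)
  have "(\<lambda>n. \<integral>t. \<bar>clip (\<phi> t) - h n t\<bar> \<partial>UI) \<longlonglongrightarrow> (\<integral>t. 0 \<partial>UI)"
  proof (rule integral_dominated_convergence[where w="\<lambda>_. b - a"])
    show "AE t in UI. (\<lambda>n. \<bar>clip (\<phi> t) - h n t\<bar>) \<longlonglongrightarrow> 0"
      using conv by eventually_elim
        (rule tendsto_eq_intros tendsto_rabs tendsto_diff tendsto_const | assumption | simp)+
    show "AE t in UI. norm \<bar>clip (\<phi> t) - h n t\<bar> \<le> b - a" for n
    proof (rule AE_I2)
      fix t
      show "norm \<bar>clip (\<phi> t) - h n t\<bar> \<le> b - a"
        using clip[of "\<phi> t"] clip[of "min 1 (real n * min t (1 - t)) * g n t"] \<eta>(1)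
        unfolding h_def by simp
    qed
  qed auto
  then have "eventually (\<lambda>n. (\<integral>t. \<bar>clip (\<phi> t) - h n t\<bar> \<partial>UI) < \<delta> / 3) sequentially"
    using \<delta> by (intro order_tendstoD) auto
  then obtain n where n: "(\<integral>t. \<bar>clip (\<phi> t) - h n t\<bar> \<partial>UI) < \<delta> / 3"
    by (auto simp: eventually_sequentially)
  have "h n 0 = h n 1" by (simp add: h_def)
  moreover have "continuous_on {0..1} (h n)"
    using cont_h continuous_on_subset by blast
  ultimately obtain H where H: "continuous_on (sphere 0 1) H"
      "\<And>t. t \<in> {0..1} \<Longrightarrow> H (circ t) = h n t"
    using continuous_on_circle_factor by blast
  \<comment> \<open>On the circle H is already clipped, so this changes nothing there; it makes the
    bounds available at every z without returning to a parameter t.\<close>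
  define H' where "H' = clip \<circ> H"
  have "continuous_on (sphere 0 1) H'"
    unfolding H'_def by (intro continuous_on_compose H cont_clip)
  moreover have H': "H' (circ t) = h n t" if "t \<in> {0..1}" for t
    using H(2)[OF that] clip[of "min 1 (real n * min t (1 - t)) * g n t"] \<eta>
    by (simp add: H'_def h_def clip_def)
  ultimately obtain p where p: "real_polynomial_function p"
      "\<And>z. z \<in> sphere 0 1 \<Longrightarrow> \<bar>H' z - p z\<bar> < \<eta>"
    using \<eta> Stone_Weierstrass_real_polynomial_function[of "sphere 0 1" H' \<eta>] by auto
  obtain P where P: "\<And>z. cmod z = 1 \<Longrightarrow> p z = Re (poly P z)"
    using real_polynomial_function_circle[OF p(1)] by blast
  have PH: "\<bar>H' z - Re (poly P z)\<bar> < \<eta>" if "cmod z = 1" for z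
    using p(2)[of z] P[OF that] that by simp
  have clip_int: "integrable UI (\<lambda>t. clip (\<phi> t) - h n t)"
  proof (rule UI.integrable_const_bound[where B="b - a"])
    show "AE t in UI. norm (clip (\<phi> t) - h n t) \<le> b - a"
    proof (rule AE_I2)
      fix t
      show "norm (clip (\<phi> t) - h n t) \<le> b - a"
        using clip[of "\<phi> t"] clip[of "min 1 (real n * min t (1 - t)) * g n t"] \<eta>(1)
        unfolding h_def by simp
    qed
  qed measurable
  have "a \<le> Re (poly P z) \<and> Re (poly P z) \<le> b" if "cmod z = 1" for z
    using PH[OF that] clip[of "H z"] by (auto simp: H'_def)
  moreover have "(\<integral>t. \<bar>\<phi> t - Re (poly P (circ t))\<bar> \<partial>UI) \<le> (\<integral>t. \<eta> + (\<bar>clip (\<phi> t) - h n t\<bar> + \<eta>) \<partial>UI)"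
  proof (rule integral_mono_AE')
    show "integrable UI (\<lambda>t. \<eta> + (\<bar>clip (\<phi> t) - h n t\<bar> + \<eta>))"
      using clip_int by auto
    have "AE t in UI. t \<in> {0..1}" by (rule AE_I2) simp
    with bd show "AE t in UI. \<bar>\<phi> t - Re (poly P (circ t))\<bar> \<le> \<eta> + (\<bar>clip (\<phi> t) - h n t\<bar> + \<eta>)"
    proof eventually_elim
      case (elim t)
      then show ?case
        using clip_near[of "\<phi> t"] PH[of "circ t"] H'[of t] by auto
    qed
  qed (use \<eta>(1) in \<open>auto intro!: AE_I2\<close>)
  moreover have "(\<integral>t. \<eta> + (\<bar>clip (\<phi> t) - h n t\<bar> + \<eta>) \<partial>UI) \<le> \<delta>"
    using n \<eta>(2) clip_int UI.prob_space by simp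
  ultimately show ?thesis by (intro exI[of _ P]) auto
qed

text \<open>Real and imaginary part are approximated separately. As b and the approximants are
  bounded by the same B, the errors are at most 2 B in absolute value, and smallness in L^1 upgrades
  to smallness in L^2.\<close>

lemma trig_approx_complex:
  assumes meas: "b \<in> borel_measurable UI" and bd: "AE t in UI. cmod (b t) \<le> C" and e: "0 < e"
  shows "\<exists>P Q. l2 UI (\<lambda>t. b t - (of_real (Re (poly P (circ t))) + \<i> * of_real (Re (poly Q (circ t))))) < e"
proof -
  define B where "B = \<bar>C\<bar> + 1"
  have "B > 0" by (simp add: B_def)
  \<comment> \<open>The two parts contribute at most 2 B \<delta> each, in total e^2 / 2.\<close>
  define \<delta> where "\<delta> = e\<^sup>2 / (8 * B)"
  have \<delta>: "\<delta> > 0" using e \<open>B > 0\<close> by (simp add: \<delta>_def)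
  note meas [measurable]
  have bR: "AE t in UI. - B \<le> Re (b t) \<and> Re (b t) \<le> B"
    using bd by eventually_elim (metis abs_Re_le_cmod abs_le_iff B_def abs_ge_self add_increasing2 order_trans zero_le_one minus_le_iff)
  have bI: "AE t in UI. - B \<le> Im (b t) \<and> Im (b t) \<le> B"
    using bd by eventually_elim (metis abs_Im_le_cmod abs_le_iff B_def abs_ge_self add_increasing2 order_trans zero_le_one minus_le_iff)
  obtain P where P: "\<And>z. cmod z = 1 \<Longrightarrow> - B \<le> Re (poly P z) \<and> Re (poly P z) \<le> B"
      and PI: "(\<integral>t. \<bar>Re (b t) - Re (poly P (circ t))\<bar> \<partial>UI) \<le> \<delta>"
    using trig_approx_real[OF _ bR _ \<delta>] \<open>B > 0\<close> by auto
  obtain Q where Q: "\<And>z. cmod z = 1 \<Longrightarrow> - B \<le> Re (poly Q z) \<and> Re (poly Q z) \<le> B"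
      and QI: "(\<integral>t. \<bar>Im (b t) - Re (poly Q (circ t))\<bar> \<partial>UI) \<le> \<delta>"
    using trig_approx_real[OF _ bI _ \<delta>] \<open>B > 0\<close> by auto
  define x y where "x t = Re (b t) - Re (poly P (circ t))" and "y t = Im (b t) - Re (poly Q (circ t))" for t
  have [measurable]: "(\<lambda>t. poly P (circ t)) \<in> borel_measurable UI" "(\<lambda>t. poly Q (circ t)) \<in> borel_measurable UI"
    by (auto intro: square_integrable_measurable)
  have [measurable]: "x \<in> borel_measurable UI" "y \<in> borel_measurable UI"
    unfolding x_def y_def by measurable
  have bx: "AE t in UI. \<bar>x t\<bar> \<le> 2 * B"
    using bR
  proof eventually_elim
    case (elim t)
    then show ?case using P[of "circ t"] by (auto simp: x_def)
  qed
  have byy: "AE t in UI. \<bar>y t\<bar> \<le> 2 * B"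
    using bI
  proof eventually_elim
    case (elim t)
    then show ?case using Q[of "circ t"] by (auto simp: y_def)
  qed
  have ix: "integrable UI x" "integrable UI y"
    using bx byy by (auto intro!: UI.integrable_const_bound[where B="2 * B"])
  let ?d = "\<lambda>t. b t - (of_real (Re (poly P (circ t))) + \<i> * of_real (Re (poly Q (circ t))))"
  have "(l2 UI ?d)\<^sup>2 \<le> (\<integral>t. 2 * B * \<bar>x t\<bar> + 2 * B * \<bar>y t\<bar> \<partial>UI)"
    unfolding l2_power2
  proof (rule integral_mono_AE')
    show "integrable UI (\<lambda>t. 2 * B * \<bar>x t\<bar> + 2 * B * \<bar>y t\<bar>)"
      using ix by auto
    show "AE t in UI. (cmod (?d t))\<^sup>2 \<le> 2 * B * \<bar>x t\<bar> + 2 * B * \<bar>y t\<bar>"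
      using bx byy
    proof eventually_elim
      case (elim t)
      have "(cmod (?d t))\<^sup>2 = \<bar>x t\<bar> * \<bar>x t\<bar> + \<bar>y t\<bar> * \<bar>y t\<bar>"
        unfolding cmod_power2 by (simp add: x_def y_def power2_eq_square)
      also have "\<dots> \<le> 2 * B * \<bar>x t\<bar> + 2 * B * \<bar>y t\<bar>"
        using elim by (intro add_mono mult_right_mono) auto
      finally show ?case .
    qed
  qed (use \<open>B > 0\<close> in \<open>auto intro!: AE_I2 add_nonneg_nonneg\<close>)
  also have "\<dots> = 2 * B * (\<integral>t. \<bar>x t\<bar> \<partial>UI) + 2 * B * (\<integral>t. \<bar>y t\<bar> \<partial>UI)"
    using ix by simp
  also have "\<dots> \<le> 2 * B * \<delta> + 2 * B * \<delta>"
    using PI QI \<open>B > 0\<close> unfolding x_def y_def by (intro add_mono mult_left_mono) auto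
  also have "\<dots> < e\<^sup>2"
    using e \<open>B > 0\<close> by (simp add: \<delta>_def field_simps)
  finally have "l2 UI ?d < e"
    using e by (intro power2_less_imp_less[of _ e]) auto
  then show ?thesis by blast
qed

text \<open>The integral of |f| is the inner product of f with its phase b = f / |f|. The phase is
  bounded, hence an L^2-limit of trigonometric polynomials, and f is orthogonal to all of
  these.\<close>

lemma fourier_uniqueness:
  assumes f: "square_integrable UI f"
    and 0: "\<And>n. (\<integral>t. f t * cnj (circ t ^ n) \<partial>UI) = 0" "\<And>n. (\<integral>t. f t * circ t ^ n \<partial>UI) = 0"
  shows "AE t in UI. f t = 0"
proof -
  have [measurable]: "f \<in> borel_measurable UI"
    using f by (rule square_integrable_measurable)
  have int: "integrable UI f"
    using square_integrable_mult[OF f, of "\<lambda>_. 1"] by (simp add: square_integrable_def)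
  \<comment> \<open>Where f vanishes the quotient is 0 by the convention for division by zero, so
    |b| <= 1 and f conj(b) = |f| hold everywhere.\<close>
  define b where "b t = f t / of_real (cmod (f t))" for t
  have [measurable]: "b \<in> borel_measurable UI"
    unfolding b_def by measurable
  have b1: "cmod (b t) \<le> 1" for t
    by (auto simp: b_def norm_divide)
  have b: "square_integrable UI b"
    by (rule UI.square_integrable_bounded[where C=1]) (auto simp: b1)
  have fb: "f t * cnj (b t) = of_real (cmod (f t))" for t
  proof -
    have "f t * cnj (b t) = (f t * cnj (f t)) / of_real (cmod (f t))"
      by (simp add: b_def)
    also have "\<dots> = of_real (cmod (f t))"
      by (subst complex_norm_square[symmetric]) (simp add: power2_eq_square)
    finally show ?thesis .
  qed
  have cP: "(\<integral>t. f t * cnj (poly P (circ t)) \<partial>UI) = 0" for P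
    by (rule integral_cnj_poly_eq_0[OF f 0(1)])
  have "(\<integral>t. cnj (f t) * cnj (poly P (circ t)) \<partial>UI) = 0" for P
  proof (rule integral_cnj_poly_eq_0)
    show "(\<integral>t. cnj (f t) * cnj (circ t ^ n) \<partial>UI) = 0" for n
      using 0(2)[of n] Bochner_Integration.integral_cnj[of UI "\<lambda>t. f t * circ t ^ n"] by simp
  qed (simp add: f)
  then have P: "(\<integral>t. f t * poly P (circ t) \<partial>UI) = 0" for P
    using Bochner_Integration.integral_cnj[of UI "\<lambda>t. f t * poly P (circ t)"] by simp
  have i: "integrable UI (\<lambda>t. f t * cnj (poly P (circ t)))" "integrable UI (\<lambda>t. f t * poly P (circ t))" for P
    by (intro square_integrable_mult f; simp)+
  have R: "(\<integral>t. f t * of_real (Re (poly P (circ t))) \<partial>UI) = 0" for P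
  proof -
    have "(\<integral>t. f t * of_real (Re (poly P (circ t))) \<partial>UI)
        = (\<integral>t. 1/2 * (f t * poly P (circ t)) + 1/2 * (f t * cnj (poly P (circ t))) \<partial>UI)"
      by (rule Bochner_Integration.integral_cong) (auto simp: complex_eq_iff field_simps)
    then show ?thesis using i P cP by simp
  qed
  have sR: "square_integrable UI (\<lambda>t. of_real (Re (poly P (circ t))))" for P
    by (rule square_integrable_circ) (intro continuous_intros)
  have iR: "integrable UI (\<lambda>t. f t * of_real (Re (poly P (circ t))))" for P
    by (intro square_integrable_mult f sR)
  have "(\<integral>t. cmod (f t) \<partial>UI) \<le> 0 + e" if e: "e > 0" for e
  proof -
    define e' where "e' = e / (l2 UI f + 1)"
    have lf: "l2 UI f + 1 > 0" by (simp add: add_nonneg_pos)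
    have e': "e' > 0" using e lf by (simp add: e'_def)
    obtain P Q where PQ: "l2 UI (\<lambda>t. b t - (of_real (Re (poly P (circ t))) + \<i> * of_real (Re (poly Q (circ t))))) < e'"
      using trig_approx_complex[of b 1 e'] e' b1 by auto
    define T where "T t = of_real (Re (poly P (circ t))) + \<i> * of_real (Re (poly Q (circ t)))" for t
    have T: "square_integrable UI T"
      unfolding T_def by (intro square_integrable_add square_integrable_cmult sR)
    have "(\<integral>t. f t * cnj (T t) \<partial>UI)
        = (\<integral>t. f t * of_real (Re (poly P (circ t))) - \<i> * (f t * of_real (Re (poly Q (circ t)))) \<partial>UI)"
      by (rule Bochner_Integration.integral_cong) (auto simp: T_def algebra_simps)
    then have fT: "(\<integral>t. f t * cnj (T t) \<partial>UI) = 0"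
      using iR R by simp
    have "complex_of_real (\<integral>t. cmod (f t) \<partial>UI) = (\<integral>t. f t * cnj (b t) \<partial>UI)"
      unfolding fb by (rule integral_complex_of_real[symmetric])
    also have "\<dots> = (\<integral>t. f t * cnj (b t - T t) + f t * cnj (T t) \<partial>UI)"
      by (simp add: algebra_simps)
    also have "\<dots> = (\<integral>t. f t * cnj (b t - T t) \<partial>UI)"
      by (subst Bochner_Integration.integral_add)
         (use fT f b T square_integrable_diff[OF b T] in \<open>auto intro!: square_integrable_mult simp del: complex_cnj_diff\<close>)
    finally have eq: "complex_of_real (\<integral>t. cmod (f t) \<partial>UI) = (\<integral>t. f t * cnj (b t - T t) \<partial>UI)" .
    have "(\<integral>t. cmod (f t) \<partial>UI) = cmod (\<integral>t. f t * cnj (b t - T t) \<partial>UI)"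
      unfolding eq[symmetric] norm_of_real by simp
    also have "\<dots> \<le> l2 UI f * l2 UI (\<lambda>t. b t - T t)"
      using l2_Cauchy_Schwarz[OF f, of "\<lambda>t. cnj (b t - T t)"] square_integrable_diff[OF b T]
      by (simp del: complex_cnj_diff)
    also have "\<dots> \<le> (l2 UI f + 1) * e'"
      using PQ e' by (intro mult_mono) (auto simp: T_def)
    also have "\<dots> = e" using lf by (simp add: e'_def)
    finally show ?thesis by simp
  qed
  then have "(\<integral>t. cmod (f t) \<partial>UI) \<le> 0"
    by (rule field_le_epsilon)
  moreover have "(\<integral>t. cmod (f t) \<partial>UI) \<ge> 0" by simp
  ultimately have "(\<integral>t. cmod (f t) \<partial>UI) = 0" by linarith
  then have "AE t in UI. cmod (f t) = 0"
    using int by (subst (asm) integral_nonneg_eq_0_iff_AE) auto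
  then show ?thesis by simp
qed

section \<open>The closure of the analytic polynomials\<close>

text \<open>In terms of boundary functions, this is membership in \<open>H\<^sup>2\<close>.\<close>
definition poly_limit :: "(real \<Rightarrow> complex) \<Rightarrow> bool" where
  "poly_limit b \<longleftrightarrow> square_integrable UI b \<and> (\<forall>e>0. \<exists>P. l2 UI (\<lambda>t. b t - poly P (circ t)) < e)"

lemma poly_limit_orthogonal:
  assumes b: "poly_limit b" and q: "square_integrable UI q"
    and 0: "\<And>n. (\<integral>t. q t * cnj (circ t ^ n) \<partial>UI) = 0"
  shows "(\<integral>t. q t * cnj (b t) \<partial>UI) = 0"
proof -
  have sb: "square_integrable UI b" using b by (simp add: poly_limit_def)
  have "cmod (\<integral>t. q t * cnj (b t) \<partial>UI) \<le> 0 + e" if e: "e > 0" for e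
  proof -
    have lq: "l2 UI q + 1 > 0" by (simp add: add_nonneg_pos)
    then obtain P where P: "l2 UI (\<lambda>t. b t - poly P (circ t)) < e / (l2 UI q + 1)"
      using b divide_pos_pos[OF e lq] unfolding poly_limit_def by blast
    have d: "square_integrable UI (\<lambda>t. b t - poly P (circ t))"
      by (intro square_integrable_diff sb) simp
    have "(\<integral>t. q t * cnj (b t) \<partial>UI)
       = (\<integral>t. q t * cnj (b t - poly P (circ t)) + q t * cnj (poly P (circ t)) \<partial>UI)"
      by (simp add: algebra_simps)
    also have "\<dots> = (\<integral>t. q t * cnj (b t - poly P (circ t)) \<partial>UI) + 0"
      by (subst Bochner_Integration.integral_add)
         (use q d integral_cnj_poly_eq_0[OF q 0] in \<open>auto intro!: square_integrable_mult simp del: complex_cnj_diff\<close>)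
    finally have "cmod (\<integral>t. q t * cnj (b t) \<partial>UI) \<le> l2 UI q * l2 UI (\<lambda>t. b t - poly P (circ t))"
      using l2_Cauchy_Schwarz[OF q, of "\<lambda>t. cnj (b t - poly P (circ t))"] d
      by (simp del: complex_cnj_diff)
    also have "\<dots> \<le> (l2 UI q + 1) * (e / (l2 UI q + 1))"
      using P lq by (intro mult_mono) auto
    also have "\<dots> = e" using lq by simp
    finally show ?thesis by simp
  qed
  then have "cmod (\<integral>t. q t * cnj (b t) \<partial>UI) \<le> 0"
    by (rule field_le_epsilon)
  then show ?thesis by simp
qed

lemma poly_limit_closed:
  assumes b: "square_integrable UI b"
    and lim: "\<And>e. 0 < e \<Longrightarrow> \<exists>b'. poly_limit b' \<and> l2 UI (\<lambda>t. b t - b' t) < e"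
  shows "poly_limit b"
  unfolding poly_limit_def
proof (intro conjI b allI impI)
  fix e :: real assume e: "0 < e"
  obtain b' where b': "poly_limit b'" "l2 UI (\<lambda>t. b t - b' t) < e / 2"
    using lim[of "e / 2"] e by auto
  obtain P where P: "l2 UI (\<lambda>t. b' t - poly P (circ t)) < e / 2"
    using b'(1) e unfolding poly_limit_def by (meson half_gt_zero)
  have sb': "square_integrable UI b'" using b' by (simp add: poly_limit_def)
  have "l2 UI (\<lambda>t. (b t - b' t) + (b' t - poly P (circ t))) \<le> l2 UI (\<lambda>t. b t - b' t) + l2 UI (\<lambda>t. b' t - poly P (circ t))"
    by (intro l2_triangle square_integrable_diff b sb') simp
  then show "\<exists>P. l2 UI (\<lambda>t. b t - poly P (circ t)) < e"
    using b' P by (intro exI[of _ P]) simp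
qed

text \<open>Approximate b by a trigonometric polynomial T and keep only its analytic part A. The
  discarded part is orthogonal to d = b - A, so ||d||^2 = <b - T, d> and therefore ||d|| <= ||b -
  T||: projecting T does not increase the distance to b.\<close>

lemma poly_limit_of_bounded_analytic:
  assumes meas: "b \<in> borel_measurable UI" and bd: "AE t in UI. cmod (b t) \<le> C"
    and neg: "\<And>n. (\<integral>t. b t * circ t ^ Suc n \<partial>UI) = 0"
  shows "poly_limit b"
  unfolding poly_limit_def
proof (intro conjI allI impI)
  show b: "square_integrable UI b"
    by (rule UI.square_integrable_bounded[OF meas bd])
  fix e :: real assume "0 < e"
  then obtain P Q where PQ: "l2 UI (\<lambda>t. b t - (of_real (Re (poly P (circ t))) + \<i> * of_real (Re (poly Q (circ t))))) < e"
    using trig_approx_complex[OF meas bd] by blast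
  define T where "T t = of_real (Re (poly P (circ t))) + \<i> * of_real (Re (poly Q (circ t)))" for t
  \<comment> \<open>Re P + i Re Q = (P + i Q)/2 + conj((P - i Q)/2). The constant b0 of the second
    half moves into A, so that the rest is conj(z B), with negative frequencies only.\<close>
  obtain b0 B where B: "smult (1/2) (P - smult \<i> Q) = pCons b0 B"
    by (metis pCons_cases)
  define A where "A = smult (1/2) (P + smult \<i> Q) + [:cnj b0:]"
  have T_eq: "T t = poly A (circ t) + cnj (circ t * poly B (circ t))" for t
  proof -
    have "circ t * poly B (circ t) = 1/2 * (poly P (circ t) - \<i> * poly Q (circ t)) - b0"
      using arg_cong[OF B, of "\<lambda>p. poly p (circ t)"] by (simp add: field_simps)
    then show ?thesis
      by (simp add: T_def A_def complex_eq_iff) (simp add: field_simps)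
  qed
  define d where "d t = b t - poly A (circ t)" for t
  have d: "square_integrable UI d"
    unfolding d_def by (intro square_integrable_diff b) simp
  have sB: "square_integrable UI (\<lambda>t. cnj (circ t * poly B (circ t)))"
    by (rule square_integrable_circ) (intro continuous_intros)
  have T: "square_integrable UI T"
    unfolding T_eq[abs_def] by (intro square_integrable_add sB) simp
  have d0: "(\<integral>t. d t * circ t ^ Suc n \<partial>UI) = 0" for n
  proof -
    have "(\<integral>t. d t * circ t ^ Suc n \<partial>UI) = (\<integral>t. b t * circ t ^ Suc n - poly (A * monom 1 (Suc n)) (circ t) \<partial>UI)"
      by (simp add: d_def algebra_simps poly_monom)
    also have "\<dots> = (\<integral>t. b t * circ t ^ Suc n \<partial>UI) - (\<integral>t. poly (A * monom 1 (Suc n)) (circ t) \<partial>UI)"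
      by (intro Bochner_Integration.integral_diff square_integrable_mult b square_integrable_circ_power
          integrable_circ continuous_intros)
    finally show ?thesis unfolding neg integral_poly_circ by (simp add: poly_monom)
  qed
  have "(\<integral>t. cnj (d t * circ t) * cnj (poly B (circ t)) \<partial>UI) = 0"
  proof (rule integral_cnj_poly_eq_0)
    have "square_integrable UI (\<lambda>t. circ t * d t)"
      by (rule square_integrable_bounded_mult[OF d, where C=1]) auto
    then show "square_integrable UI (\<lambda>t. cnj (d t * circ t))"
      by (subst square_integrable_cnj) (simp add: mult.commute)
    show "(\<integral>t. cnj (d t * circ t) * cnj (circ t ^ n) \<partial>UI) = 0" for n
      using d0[of n] Bochner_Integration.integral_cnj[of UI "\<lambda>t. d t * circ t ^ Suc n"] by (simp add: mult.assoc)
  qed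
  then have z: "(\<integral>t. cnj (circ t * poly B (circ t)) * cnj (d t) \<partial>UI) = 0"
    by (simp add: mult_ac)
  have "complex_of_real ((l2 UI d)\<^sup>2) = (\<integral>t. d t * cnj (d t) \<partial>UI)"
    by (rule integral_norm_power2)
  also have "\<dots> = (\<integral>t. (b t - T t) * cnj (d t) + cnj (circ t * poly B (circ t)) * cnj (d t) \<partial>UI)"
    by (rule Bochner_Integration.integral_cong) (auto simp: T_eq d_def algebra_simps)
  also have "\<dots> = (\<integral>t. (b t - T t) * cnj (d t) \<partial>UI)"
    by (subst Bochner_Integration.integral_add)
       (use z b T d sB in \<open>auto intro!: square_integrable_mult square_integrable_diff simp del: complex_cnj_mult\<close>)
  finally have eq: "complex_of_real ((l2 UI d)\<^sup>2) = (\<integral>t. (b t - T t) * cnj (d t) \<partial>UI)" .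
  have "(l2 UI d)\<^sup>2 = cmod (\<integral>t. (b t - T t) * cnj (d t) \<partial>UI)"
    unfolding eq[symmetric] norm_of_real by simp
  also have "\<dots> \<le> l2 UI (\<lambda>t. b t - T t) * l2 UI d"
    using l2_Cauchy_Schwarz[of UI "\<lambda>t. b t - T t" "\<lambda>t. cnj (d t)"] square_integrable_diff[OF b T] d by simp
  finally have "l2 UI d * l2 UI d \<le> l2 UI (\<lambda>t. b t - T t) * l2 UI d"
    by (simp add: power2_eq_square)
  then have "l2 UI d \<le> l2 UI (\<lambda>t. b t - T t)"
    by (cases "l2 UI d = 0") (auto simp: mult_le_cancel_right less_le)
  then show "\<exists>P. l2 UI (\<lambda>t. b t - poly P (circ t)) < e"
    using PQ unfolding d_def T_def by (intro exI[of _ A]) simp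
qed

section \<open>Polynomial approximation of holomorphic functions and of dilations\<close>

lemma holomorphic_poly_approx:
  assumes f: "f holomorphic_on ball 0 R" and R: "1 < R" and e: "0 < e"
  obtains P where "poly P 0 = f 0" "\<And>z. cmod z \<le> 1 \<Longrightarrow> cmod (f z - poly P z) < e"
proof -
  define a where "a n = (deriv ^^ n) f 0 / fact n" for n
  have sums: "(\<lambda>n. a n * z ^ n) sums f z" if "cmod z < R" for z
    using holomorphic_power_series[OF f, of z] that by (simp add: a_def)
  define \<rho> where "\<rho> = (1 + R) / 2"
  have \<rho>: "1 < \<rho>" "\<rho> < R" using R by (auto simp: \<rho>_def)
  have "summable (\<lambda>n. a n * of_real \<rho> ^ n)"
    using sums[of "of_real \<rho>"] \<rho> by (auto simp: summable_def)
  then have sa: "summable (\<lambda>n. cmod (a n))"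
    using powser_insidea[of a "of_real \<rho>" 1] \<rho> by simp
  then obtain N where N: "\<And>n. n \<ge> N \<Longrightarrow> norm (\<Sum>i. cmod (a (i + n))) < e"
    using suminf_exist_split[OF e sa] by blast
  \<comment> \<open>\<open>Suc N\<close> terms, so that the constant term is present even for N = 0;
    this gives P(0) = f(0).\<close>
  define P where "P = (\<Sum>n<Suc N. monom (a n) n)"
  have P: "poly P z = (\<Sum>n<Suc N. a n * z ^ n)" for z
    by (simp add: P_def poly_sum poly_monom del: sum.lessThan_Suc)
  have "a 0 = f 0" by (simp add: a_def)
  then have "poly P 0 = f 0"
    unfolding P by (subst sum.lessThan_Suc_shift) simp
  moreover have "cmod (f z - poly P z) < e" if z: "cmod z \<le> 1" for z
  proof -
    have s: "(\<lambda>n. a n * z ^ n) sums f z" using sums[of z] z R by simp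
    have "(\<lambda>i. a (i + Suc N) * z ^ (i + Suc N)) sums (f z - poly P z)"
      unfolding P using sums_split_initial_segment[OF s, of "Suc N"] by simp
    then have "f z - poly P z = (\<Sum>i. a (i + Suc N) * z ^ (i + Suc N))"
      by (simp add: sums_iff)
    moreover have le: "cmod (a i * z ^ i) \<le> cmod (a i)" for i
      using z by (simp add: norm_mult norm_power mult_left_le power_le_one)
    have sa': "summable (\<lambda>i. cmod (a (i + Suc N)))"
      using sa by (rule summable_ignore_initial_segment)
    have "cmod (\<Sum>i. a (i + Suc N) * z ^ (i + Suc N)) \<le> (\<Sum>i. cmod (a (i + Suc N)))"
      by (rule norm_suminf_le[OF le sa'])
    also have "\<dots> \<le> norm (\<Sum>i. cmod (a (i + Suc N)))" by simp
    also have "\<dots> < e" using N[of "Suc N"] by simp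
    finally show ?thesis using \<open>f z - poly P z = _\<close> by simp
  qed
  ultimately show ?thesis by (rule that)
qed

text \<open>Both facts follow from uniform approximation on the circle by polynomials that agree
  with f at 0. The first is applied to dilations, the second to exp of a polynomial.\<close>

lemma
  assumes f: "f holomorphic_on ball 0 R" and R: "1 < R"
  shows poly_limit_holomorphic: "poly_limit (\<lambda>t. f (circ t))"
    and integral_holomorphic_circ: "(\<integral>t. f (circ t) \<partial>UI) = f 0"
proof -
  have cont: "continuous_on (sphere 0 1) f"
    by (rule continuous_on_subset[OF holomorphic_on_imp_continuous_on[OF f]]) (use R in auto)
  have app: "\<exists>P. poly P 0 = f 0 \<and> (\<forall>t. cmod (f (circ t) - poly P (circ t)) \<le> e)" if "e > 0" for e
    using holomorphic_poly_approx[OF f R that] by (metis cmod_circ order_refl less_imp_le)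
  have sf: "square_integrable UI (\<lambda>t. f (circ t))"
    by (rule square_integrable_circ[OF cont])
  have m: "(\<lambda>t. f (circ t) - poly P (circ t)) \<in> borel_measurable UI" for P
    by (intro square_integrable_measurable square_integrable_diff sf) simp
  show "poly_limit (\<lambda>t. f (circ t))"
    unfolding poly_limit_def
  proof (intro conjI allI impI sf)
    fix e :: real assume e: "e > 0"
    obtain P where "\<And>t. cmod (f (circ t) - poly P (circ t)) \<le> e / 2"
      using app[of "e / 2"] e by auto
    then have "l2 UI (\<lambda>t. f (circ t) - poly P (circ t)) \<le> e / 2"
      using e by (intro UI.l2_bounded m) auto
    then show "\<exists>P. l2 UI (\<lambda>t. f (circ t) - poly P (circ t)) < e"
      using e by (intro exI[of _ P]) simp
  qed
  have "cmod ((\<integral>t. f (circ t) \<partial>UI) - f 0) \<le> 0 + e" if e: "e > 0" for e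
  proof -
    obtain P where P: "poly P 0 = f 0" "\<And>t. cmod (f (circ t) - poly P (circ t)) \<le> e"
      using app[OF e] by auto
    have "(\<integral>t. f (circ t) \<partial>UI) - f 0 = (\<integral>t. f (circ t) - poly P (circ t) \<partial>UI)"
      unfolding P(1)[symmetric] integral_poly_circ[symmetric]
      by (intro Bochner_Integration.integral_diff[symmetric] integrable_circ cont continuous_intros)
    also have "cmod \<dots> \<le> (\<integral>t. e \<partial>UI)"
      by (rule Bochner_Integration.integral_norm_bound_integral)
         (use P in \<open>auto intro!: Bochner_Integration.integrable_diff integrable_circ cont continuous_intros\<close>)
    also have "\<dots> = e" using UI.prob_space by simp
    finally show ?thesis by simp
  qed
  then have "cmod ((\<integral>t. f (circ t) \<partial>UI) - f 0) \<le> 0"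
    by (rule field_le_epsilon)
  then show "(\<integral>t. f (circ t) \<partial>UI) = f 0" by simp
qed

lemma poly_eq_sum_lessThan:
  fixes P :: "complex poly"
  assumes "degree P < N"
  shows "poly P z = (\<Sum>n<N. coeff P n * z ^ n)"
proof -
  have "(\<Sum>n\<le>degree P. coeff P n * z ^ n) = (\<Sum>n<N. coeff P n * z ^ n)"
    by (rule sum.mono_neutral_left) (use assms in \<open>auto simp: coeff_eq_0\<close>)
  then show ?thesis by (simp only: poly_altdef)
qed

lemma integral_poly_circ_cnj:
  "(\<integral>t. poly P (circ t) * cnj (circ t ^ n) \<partial>UI) = coeff P n"
proof -
  have i: "integrable UI (\<lambda>t. circ t ^ i * cnj (circ t ^ j))" for i j
    by (intro square_integrable_mult) (simp_all del: complex_cnj_power)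
  \<comment> \<open>The sum is extended beyond the degree so that the index n occurs in it even when
    the coefficient is 0.\<close>
  define N where "N = Suc (max (degree P) n)"
  have "(\<integral>t. poly P (circ t) * cnj (circ t ^ n) \<partial>UI)
      = (\<integral>t. (\<Sum>i<N. coeff P i * (circ t ^ i * cnj (circ t ^ n))) \<partial>UI)"
    by (subst poly_eq_sum_lessThan[of P N])
       (simp_all add: N_def sum_distrib_right mult.assoc del: complex_cnj_power sum.lessThan_Suc)
  also have "\<dots> = (\<Sum>i<N. coeff P i * (if i = n then 1 else 0))"
    using i by (subst Bochner_Integration.integral_sum)
      (auto simp: integral_circ_power_cnj simp del: complex_cnj_power)
  also have "\<dots> = coeff P n"
    by (simp add: N_def if_distrib cong: if_cong)
  finally show ?thesis .
qed

lemma norm_coeff_le_l2: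
  assumes "square_integrable UI q"
  shows "cmod (\<integral>t. q t * cnj (circ t ^ n) \<partial>UI) \<le> l2 UI q"
  using Bessel_inequality[OF assms, of "{n}"] by (simp add: power2_le_iff_abs_le del: complex_cnj_power)

lemma power_series_sums_disc:
  assumes "\<And>n. cmod (c n) \<le> K" "cmod z < 1"
  shows "summable (\<lambda>n. cmod (c n * z ^ n))"
proof (rule summable_comparison_test[OF exI[of _ 0]])
  show "summable (\<lambda>n. K * cmod z ^ n)"
    using assms(2) by (intro summable_mult summable_geometric) simp
  show "\<forall>n\<ge>0. norm (cmod (c n * z ^ n)) \<le> K * cmod z ^ n"
    using assms(1) by (auto simp: norm_mult norm_power intro: mult_right_mono)
qed

text \<open>For a polynomial, dilation changes little, by uniform continuity. For the difference of
  b and a polynomial, dilation multiplies the n-th coefficient by r^n and so does not increase the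
  L^2-norm. Partial sums stand in for the dilated series, whose tail is uniformly small.\<close>

lemma dilation_approx:
  assumes b: "poly_limit b" and e: "0 < e"
    and G: "\<And>z. cmod z < 1 \<Longrightarrow> G z = (\<Sum>n. (\<integral>t. b t * cnj (circ t ^ n) \<partial>UI) * z ^ n)"
  obtains r where "0 < r" "r < 1" "l2 UI (\<lambda>t. b t - G (of_real r * circ t)) < e"
proof -
  have sb: "square_integrable UI b" using b by (simp add: poly_limit_def)
  define c where "c n = (\<integral>t. b t * cnj (circ t ^ n) \<partial>UI)" for n
  \<comment> \<open>Four errors of at most e/5 each leave a strict inequality.\<close>
  define e' where "e' = e / 5"
  have e': "e' > 0" using e by (simp add: e'_def)
  obtain P where P: "l2 UI (\<lambda>t. b t - poly P (circ t)) < e'"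
    using b e' unfolding poly_limit_def by blast
  define d where "d t = b t - poly P (circ t)" for t
  have sd: "square_integrable UI d"
    unfolding d_def by (intro square_integrable_diff sb) simp
  have ib: "integrable UI (\<lambda>t. q t * cnj (circ t ^ n))" if "square_integrable UI q" for q n
    using that by (intro square_integrable_mult) (simp_all del: complex_cnj_power)
  have dn: "(\<integral>t. d t * cnj (circ t ^ n) \<partial>UI) = c n - coeff P n" for n
    unfolding d_def left_diff_distrib
    by (subst Bochner_Integration.integral_diff)
       (simp_all add: ib sb c_def integral_poly_circ_cnj del: complex_cnj_power)
  have "uniformly_continuous_on (cball 0 1) (poly P)"
    by (intro compact_uniformly_continuous continuous_intros) simp
  then obtain \<delta> where \<delta>: "\<delta> > 0"
      "\<And>z w. z \<in> cball 0 1 \<Longrightarrow> w \<in> cball 0 1 \<Longrightarrow> dist w z < \<delta> \<Longrightarrow> dist (poly P w) (poly P z) < e'"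
    using e' unfolding uniformly_continuous_on_def by metis
  \<comment> \<open>1 - r is at most \<delta>/2, and the bound 1/2 keeps r positive when \<delta> is
    large.\<close>
  define r where "r = max (1/2) (1 - \<delta> / 2)"
  have r: "0 < r" "r < 1" "1 - r < \<delta>" using \<delta>(1) by (auto simp: r_def)
  have cr: "cmod (of_real r * circ t) = r" for t
    using r by (simp add: norm_mult)
  have Pr: "cmod (poly P (circ t) - poly P (of_real r * circ t)) \<le> e'" for t
  proof -
    have "circ t - of_real r * circ t = of_real (1 - r) * circ t"
      by (simp add: algebra_simps)
    then have "dist (circ t) (of_real r * circ t) = 1 - r"
      using r by (simp add: dist_norm norm_mult del: of_real_diff)
    then have "dist (poly P (circ t)) (poly P (of_real r * circ t)) < e'"
      using r cr[of t] by (intro \<delta>(2)) auto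
    then show ?thesis by (simp add: dist_norm)
  qed
  have cK: "cmod (c n) \<le> l2 UI b" for n
    unfolding c_def by (rule norm_coeff_le_l2[OF sb])
  have sc: "summable (\<lambda>n. cmod (c n * z ^ n))" if "cmod z < 1" for z
    by (rule power_series_sums_disc[OF cK that])
  have sr: "summable (\<lambda>n. cmod (c n) * r ^ n)"
    using sc[of "of_real r"] r by (simp add: norm_mult norm_power)
  obtain N0 where N0: "\<And>n. n \<ge> N0 \<Longrightarrow> norm (\<Sum>i. cmod (c (i + n)) * r ^ (i + n)) < e'"
    using suminf_exist_split[OF e' sr] by blast
  \<comment> \<open>Beyond N0 the tail is small; beyond the degree, P and the partial sum S run over
    the same indices.\<close>
  define N where "N = max N0 (Suc (degree P))"
  define S where "S t = (\<Sum>n<N. c n * (of_real r * circ t) ^ n)" for t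
  have GS: "cmod (S t - G (of_real r * circ t)) \<le> e'" for t
  proof -
    define z where "z = of_real r * circ t"
    have z: "cmod z = r" by (simp add: z_def cr)
    have "(\<lambda>n. c n * z ^ n) sums G z"
      using sc[of z] z r G[of z] by (simp add: c_def summable_norm_cancel summable_sums del: complex_cnj_power)
    then have "(\<lambda>i. c (i + N) * z ^ (i + N)) sums (G z - S t)"
      unfolding S_def z_def[symmetric] by (rule sums_split_initial_segment)
    then have "G z - S t = (\<Sum>i. c (i + N) * z ^ (i + N))"
      by (simp add: sums_iff)
    also have "cmod \<dots> \<le> (\<Sum>i. cmod (c (i + N)) * r ^ (i + N))"
      using summable_ignore_initial_segment[OF sr, of N]
      by (intro norm_suminf_le) (auto simp: norm_mult norm_power z)
    also have "\<dots> \<le> norm (\<Sum>i. cmod (c (i + N)) * r ^ (i + N))" by simp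
    also have "\<dots> < e'" using N0[of N] by (simp add: N_def)
    finally show ?thesis by (simp add: z_def norm_minus_commute)
  qed
  \<comment> \<open>Up to sign the coefficients are those of d times r^n, so Parseval and Bessel
    bound the norm by that of d.\<close>
  have PS: "poly P (of_real r * circ t) - S t = (\<Sum>n<N. ((coeff P n - c n) * of_real r ^ n) * circ t ^ n)" for t
    unfolding S_def
    by (subst poly_eq_sum_lessThan[of P N])
       (auto simp: N_def sum_subtractf[symmetric] power_mult_distrib algebra_simps intro!: sum.cong)
  have "(l2 UI (\<lambda>t. poly P (of_real r * circ t) - S t))\<^sup>2 = (\<Sum>n<N. (cmod ((coeff P n - c n) * of_real r ^ n))\<^sup>2)"
    unfolding PS by (rule l2_trig_sum) simp
  also have "\<dots> \<le> (\<Sum>n<N. (cmod (c n - coeff P n))\<^sup>2)"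
    using r by (intro sum_mono power_mono)
      (auto simp: norm_mult norm_power norm_minus_commute mult_left_le power_le_one)
  also have "\<dots> \<le> (l2 UI d)\<^sup>2"
    using Bessel_inequality[OF sd, of "{..<N}"] unfolding dn by simp
  finally have "l2 UI (\<lambda>t. poly P (of_real r * circ t) - S t) \<le> l2 UI d"
    by (rule power2_le_imp_le) simp
  then have l3: "l2 UI (\<lambda>t. poly P (of_real r * circ t) - S t) < e'"
    using P unfolding d_def by simp
  have c1: "continuous_on (sphere 0 1) (\<lambda>z. poly P (of_real r * z))"
    by (intro continuous_intros)
  have sPr: "square_integrable UI (\<lambda>t. poly P (of_real r * circ t))"
    by (rule square_integrable_circ[OF c1])
  have sS: "square_integrable UI S"
    unfolding S_def by (rule square_integrable_circ[where F="\<lambda>z. \<Sum>n<N. c n * (of_real r * z) ^ n"])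
      (intro continuous_intros)
  have contG: "continuous_on (sphere 0 1) (\<lambda>z. G (of_real r * z))"
  proof -
    have "G holomorphic_on ball 0 1"
    proof (rule power_series_holomorphic)
      fix w assume "w \<in> ball (0::complex) 1"
      then show "(\<lambda>n. c n * (w - 0) ^ n) sums G w"
        using sc[of w] G[of w] by (simp add: c_def summable_norm_cancel summable_sums del: complex_cnj_power)
    qed
    then have "continuous_on (ball 0 1) G"
      by (rule holomorphic_on_imp_continuous_on)
    then show ?thesis
      by (rule continuous_on_compose2) (use r in \<open>auto intro!: continuous_intros simp: norm_mult\<close>)
  qed
  have sG: "square_integrable UI (\<lambda>t. G (of_real r * circ t))"
    by (rule square_integrable_circ[OF contG])
  have l2': "l2 UI (\<lambda>t. poly P (circ t) - poly P (of_real r * circ t)) \<le> e'"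
    by (rule UI.l2_bounded[OF square_integrable_measurable])
       (use Pr e' sPr in \<open>auto intro!: square_integrable_diff\<close>)
  have l4: "l2 UI (\<lambda>t. S t - G (of_real r * circ t)) \<le> e'"
    by (rule UI.l2_bounded[OF square_integrable_measurable])
       (use GS e' sS sG in \<open>auto intro!: square_integrable_diff\<close>)
  have "l2 UI (\<lambda>t. b t - G (of_real r * circ t))
     = l2 UI (\<lambda>t. ((b t - poly P (circ t)) + (poly P (circ t) - poly P (of_real r * circ t)))
               + ((poly P (of_real r * circ t) - S t) + (S t - G (of_real r * circ t))))"
    by simp
  also have "\<dots> \<le> l2 UI (\<lambda>t. (b t - poly P (circ t)) + (poly P (circ t) - poly P (of_real r * circ t)))
     + l2 UI (\<lambda>t. (poly P (of_real r * circ t) - S t) + (S t - G (of_real r * circ t)))"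
    by (intro l2_triangle square_integrable_add square_integrable_diff sb sPr sS sG square_integrable_poly_circ)
  also have "\<dots> \<le> (l2 UI (\<lambda>t. b t - poly P (circ t)) + l2 UI (\<lambda>t. poly P (circ t) - poly P (of_real r * circ t)))
     + (l2 UI (\<lambda>t. poly P (of_real r * circ t) - S t) + l2 UI (\<lambda>t. S t - G (of_real r * circ t)))"
    by (intro add_mono l2_triangle square_integrable_diff sb sPr sS sG square_integrable_poly_circ)
  also have "\<dots> < e"
    using P l2' l3 l4 e' unfolding e'_def by linarith
  finally show ?thesis using r by (intro that[of r])
qed

text \<open>Both inverses lie in the closed unit disc, where the k-th power is k-Lipschitz.\<close>

lemma norm_inverse_power_diff_le:
  fixes x y :: complex
  assumes "1 \<le> cmod x" "1 \<le> cmod y"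
  shows "cmod (inverse x ^ k - inverse y ^ k) \<le> real k * cmod (x - y)"
proof -
  have "cmod (inverse x ^ k - inverse y ^ k) \<le> real k * cmod (inverse x - inverse y)"
    by (rule norm_power_diff) (use assms in \<open>auto simp: norm_inverse inverse_le_1_iff\<close>)
  also have "cmod (inverse x - inverse y) = cmod (x - y) / (cmod x * cmod y)"
  proof -
    have "x \<noteq> 0" "y \<noteq> 0" using assms by auto
    then have "inverse x - inverse y = (y - x) / (x * y)" by (simp add: field_simps)
    then show ?thesis by (simp add: norm_divide norm_mult norm_minus_commute)
  qed
  also have "\<dots> \<le> cmod (x - y)"
    using assms mult_mono[of 1 "cmod x" 1 "cmod y"]
    by (simp add: divide_le_eq mult_le_cancel_left1 zero_less_mult_iff) 
  finally show ?thesis by (simp add: mult_left_mono)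
qed

text \<open>The approximants are 1/G(rz)^k F(z), holomorphic on the disc of radius 1/r > 1 since G
  has no zeros. With |F| <= B on the circle they differ from the given function by at most k B times
  the L^2-distance from b to the dilation of G.\<close>

lemma poly_limit_inverse_power:
  assumes b: "poly_limit b" and b1: "AE t in UI. 1 \<le> cmod (b t)"
    and G: "\<And>z. cmod z < 1 \<Longrightarrow> G z = (\<Sum>n. (\<integral>t. b t * cnj (circ t ^ n) \<partial>UI) * z ^ n)"
    and G1: "\<And>z. cmod z < 1 \<Longrightarrow> 1 \<le> cmod (G z)"
    and F: "F holomorphic_on UNIV"
  shows "poly_limit (\<lambda>t. inverse (b t) ^ k * F (circ t))"
proof (rule poly_limit_closed)
  have sb: "square_integrable UI b" using b by (simp add: poly_limit_def)
  have [measurable]: "b \<in> borel_measurable UI" using sb by (rule square_integrable_measurable)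
  have contF: "continuous_on (sphere 0 1) F"
    using holomorphic_on_imp_continuous_on[OF F] by (rule continuous_on_subset) simp
  have sF: "square_integrable UI (\<lambda>t. F (circ t))"
    by (rule square_integrable_circ[OF contF])
  have [measurable]: "(\<lambda>t. F (circ t)) \<in> borel_measurable UI" using sF by (rule square_integrable_measurable)
  obtain B where B: "B > 0" "\<And>z. cmod z = 1 \<Longrightarrow> cmod (F z) \<le> B"
    using continuous_circle_bounded[OF contF] by blast
  have inv1: "cmod (inverse x ^ k) \<le> 1" if "1 \<le> cmod x" for x
    using that by (simp add: norm_power norm_inverse inverse_le_1_iff power_le_one)
  show s: "square_integrable UI (\<lambda>t. inverse (b t) ^ k * F (circ t))"
    by (rule square_integrable_bounded_mult[OF sF, where C=1], measurable)
       (use b1 in eventually_elim, rule inv1)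
  fix e :: real assume e: "0 < e"
  \<comment> \<open>The added 1 keeps the denominator positive for k = 0 and makes the final
    inequality strict.\<close>
  define e' where "e' = e / (real k * B + 1)"
  have kB: "real k * B + 1 > 0" using B by (simp add: add_nonneg_pos)
  have "e' > 0" using e kB by (simp add: e'_def)
  then obtain r where r: "0 < r" "r < 1" and lr: "l2 UI (\<lambda>t. b t - G (of_real r * circ t)) < e'"
    using dilation_approx[OF b _ G] by blast
  define f where "f z = inverse (G (of_real r * z)) ^ k * F z" for z
  have cK: "cmod (\<integral>t. b t * cnj (circ t ^ n) \<partial>UI) \<le> l2 UI b" for n
    by (rule norm_coeff_le_l2[OF sb])
  have Ghol: "G holomorphic_on ball 0 1"
  proof (rule power_series_holomorphic)
    fix w assume "w \<in> ball (0::complex) 1"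
    then show "(\<lambda>n. (\<integral>t. b t * cnj (circ t ^ n) \<partial>UI) * (w - 0) ^ n) sums G w"
      using power_series_sums_disc[OF cK, of w] G[of w] 
      by (simp add: summable_norm_cancel summable_sums del: complex_cnj_power)
  qed
  have im: "(\<lambda>z. of_real r * z) ` ball 0 (1 / r) \<subseteq> ball (0::complex) 1"
    using r by (auto simp: norm_mult field_simps)
  have hG: "(\<lambda>z. G (of_real r * z)) holomorphic_on ball 0 (1 / r)"
    using holomorphic_on_compose_gen[OF _ Ghol, of "\<lambda>z. of_real r * z" "ball 0 (1 / r)"] im
    by (auto simp: o_def intro!: holomorphic_intros)
  have Gr1: "1 \<le> cmod (G (of_real r * z))" if "cmod z < 1 / r" for z
    by (rule G1) (use r that in \<open>simp add: norm_mult field_simps\<close>)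
  have fhol: "f holomorphic_on ball 0 (1 / r)"
    unfolding f_def
    by (intro holomorphic_intros hG holomorphic_on_subset[OF F]) (use Gr1 in force)+
  have "1 < 1 / r" using r by simp
  have "poly_limit (\<lambda>t. f (circ t))"
    by (rule poly_limit_holomorphic[OF fhol \<open>1 < 1 / r\<close>])
  moreover have "l2 UI (\<lambda>t. inverse (b t) ^ k * F (circ t) - f (circ t)) < e"
  proof -
    have sG: "square_integrable UI (\<lambda>t. G (of_real r * circ t))"
      by (rule square_integrable_circ, rule continuous_on_subset[OF holomorphic_on_imp_continuous_on[OF hG]])
         (use \<open>1 < 1 / r\<close> in auto)
    have "l2 UI (\<lambda>t. inverse (b t) ^ k * F (circ t) - f (circ t))
        \<le> (real k * B) * l2 UI (\<lambda>t. b t - G (of_real r * circ t))"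
    proof (rule l2_AE_le)
      show "square_integrable UI (\<lambda>t. b t - G (of_real r * circ t))"
        by (intro square_integrable_diff sb sG)
      have "poly_limit (\<lambda>t. f (circ t))" by fact
      then show "(\<lambda>t. inverse (b t) ^ k * F (circ t) - f (circ t)) \<in> borel_measurable UI"
        by (intro square_integrable_measurable square_integrable_diff s) (simp add: poly_limit_def)
      show "0 \<le> real k * B" using B by simp
      show "AE t in UI. cmod (inverse (b t) ^ k * F (circ t) - f (circ t))
          \<le> real k * B * cmod (b t - G (of_real r * circ t))"
        using b1
      proof eventually_elim
        case (elim t)
        have "cmod (inverse (b t) ^ k * F (circ t) - f (circ t))
            = cmod (inverse (b t) ^ k - inverse (G (of_real r * circ t)) ^ k) * cmod (F (circ t))"
          by (simp add: f_def left_diff_distrib flip: norm_mult)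
        also have "\<dots> \<le> (real k * cmod (b t - G (of_real r * circ t))) * B"
          using elim Gr1[of "circ t"] \<open>1 < 1 / r\<close> B
          by (intro mult_mono norm_inverse_power_diff_le) auto
        finally show ?case by (simp add: mult_ac)
      qed
    qed
    also have "\<dots> \<le> real k * B * e'"
      using lr B by (intro mult_left_mono) auto
    also have "\<dots> < (real k * B + 1) * e'"
      using \<open>e' > 0\<close> by simp
    also have "\<dots> = e" using kB by (simp add: e'_def)
    finally show ?thesis .
  qed
  ultimately show "\<exists>b'. poly_limit b' \<and> l2 UI (\<lambda>t. inverse (b t) ^ k * F (circ t) - b' t) < e"
    by blast
qed

section \<open>The Riesz projection\<close>

lemma set_integral_UI:
  fixes F :: "real \<Rightarrow> 'b::{banach, second_countable_topology}"
  shows "(LINT t:{0..1}|lborel. F t) = (\<integral>t. F t \<partial>UI)"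
  by (simp add: set_lebesgue_integral_def integral_restrict_space)

lemma set_integrable_UI:
  fixes F :: "real \<Rightarrow> 'b::{banach, second_countable_topology}"
  shows "set_integrable lborel {0..1} F \<longleftrightarrow> integrable UI F"
  by (simp add: set_integrable_def integrable_restrict_space)

lemma AE_UI: "(AE t in UI. P t) \<longleftrightarrow> (AE t in lborel. t \<in> {0..1} \<longrightarrow> P t)"
  by (simp add: AE_restrict_space_iff)

lemma L2T_iff:
  "L2T h \<longleftrightarrow> (\<lambda>t. h (circ t)) \<in> borel_measurable lborel \<and> square_integrable UI (\<lambda>t. h (circ t))"
  by (auto simp: L2T_def square_integrable_def set_integrable_UI intro: measurable_restrict_space1)

lemma L2norm_eq_l2: "L2norm h = l2 UI (\<lambda>t. h (circ t))"
  by (simp add: L2norm_def l2_def set_integral_UI)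

lemma fcoeff_of_nat: "fcoeff h (int n) = (\<integral>t. h (circ t) * cnj (circ t ^ n) \<partial>UI)"
  unfolding fcoeff_def set_integral_UI circ_power cis_cnj by simp

lemma fcoeff_neg_of_nat: "fcoeff h (- int n) = (\<integral>t. h (circ t) * circ t ^ n \<partial>UI)"
  unfolding fcoeff_def set_integral_UI circ_power by simp

lemma H2_iff: "H2 h \<longleftrightarrow> L2T h \<and> (\<forall>n. (\<integral>t. h (circ t) * circ t ^ Suc n \<partial>UI) = 0)"
proof -
  have "(\<forall>n<0. fcoeff h n = 0) \<longleftrightarrow> (\<forall>n. fcoeff h (- int (Suc n)) = 0)"
    by (metis neg_int_cases negative_zless_0 int_zle_neg not_less_zero Suc_pred' 
        of_nat_0_less_iff zero_less_Suc neg_less_0_iff_less)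
  then show ?thesis unfolding H2_def fcoeff_neg_of_nat by blast
qed

section \<open>Existence of the projection by a Riesz-Fischer argument\<close>

lemma AE_summable_of_summable_integral:
  fixes f :: "nat \<Rightarrow> 'a \<Rightarrow> complex"
  assumes int: "\<And>k. integrable M (f k)" and sum: "summable (\<lambda>k. \<integral>x. cmod (f k x) \<partial>M)"
  shows "AE x in M. summable (\<lambda>k. cmod (f k x))"
proof -
  have [measurable]: "f k \<in> borel_measurable M" for k using int by auto
  have "(\<integral>\<^sup>+x. (\<Sum>k. ennreal (cmod (f k x))) \<partial>M) = (\<Sum>k. \<integral>\<^sup>+x. ennreal (cmod (f k x)) \<partial>M)"
    by (rule nn_integral_suminf) measurable
  also have "\<dots> = (\<Sum>k. ennreal (\<integral>x. cmod (f k x) \<partial>M))"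
    using int by (intro suminf_cong nn_integral_eq_integral) auto
  also have "\<dots> = ennreal (\<Sum>k. \<integral>x. cmod (f k x) \<partial>M)"
    by (rule suminf_ennreal2) (use sum in auto)
  finally have "(\<integral>\<^sup>+x. (\<Sum>k. ennreal (cmod (f k x))) \<partial>M) \<noteq> \<infinity>" by simp
  then have "AE x in M. (\<Sum>k. ennreal (cmod (f k x))) \<noteq> \<infinity>"
    by (intro nn_integral_PInf_AE) measurable
  then show ?thesis
    by eventually_elim (auto intro: summable_suminf_not_top)
qed

lemma integral_norm_le_l2:
  assumes "square_integrable UI a"
  shows "(\<integral>t. cmod (a t) \<partial>UI) \<le> l2 UI a"
  using l2_Cauchy_Schwarz_norm[OF assms, of "\<lambda>_. 1"] UI.prob_space
  by (simp add: square_integrable_def l2_def)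

lemma integrable_of_square_integrable:
  assumes "square_integrable UI a"
  shows "integrable UI a"
  using square_integrable_mult[OF assms, of "\<lambda>_. 1"] by (simp add: square_integrable_def)

lemma square_integrable_Fatou:
  assumes [measurable]: "s \<in> borel_measurable M"
    and sq: "\<And>k. square_integrable M (S k)" and bd: "\<And>k. l2 M (S k) \<le> K"
    and lim: "AE x in M. (\<lambda>k. S k x) \<longlonglongrightarrow> s x"
  shows "square_integrable M s"
proof -
  have [measurable]: "S k \<in> borel_measurable M" for k
    using sq by (rule square_integrable_measurable)
  have "(\<integral>\<^sup>+x. ennreal ((cmod (s x))\<^sup>2) \<partial>M) = (\<integral>\<^sup>+x. liminf (\<lambda>k. ennreal ((cmod (S k x))\<^sup>2)) \<partial>M)"
  proof (rule nn_integral_cong_AE)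
    show "AE x in M. ennreal ((cmod (s x))\<^sup>2) = liminf (\<lambda>k. ennreal ((cmod (S k x))\<^sup>2))"
      using lim
    proof eventually_elim
      case (elim x)
      then have "(\<lambda>k. ennreal ((cmod (S k x))\<^sup>2)) \<longlonglongrightarrow> ennreal ((cmod (s x))\<^sup>2)"
        by (intro tendsto_intros)
      then show ?case by (intro lim_imp_Liminf[symmetric]) auto
    qed
  qed
  also have "\<dots> \<le> liminf (\<lambda>k. \<integral>\<^sup>+x. ennreal ((cmod (S k x))\<^sup>2) \<partial>M)"
    by (rule nn_integral_liminf) measurable
  also have "\<dots> \<le> ennreal (K\<^sup>2)"
  proof (rule Liminf_le)
    have "(\<integral>\<^sup>+x. ennreal ((cmod (S k x))\<^sup>2) \<partial>M) \<le> ennreal (K\<^sup>2)" for k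
    proof -
      have "(\<integral>\<^sup>+x. ennreal ((cmod (S k x))\<^sup>2) \<partial>M) = ennreal ((l2 M (S k))\<^sup>2)"
        unfolding l2_power2 using sq by (intro nn_integral_eq_integral) (auto simp: square_integrable_def)
      also have "\<dots> \<le> ennreal (K\<^sup>2)"
        by (intro ennreal_leI power_mono bd) simp
      finally show ?thesis .
    qed
    then show "\<forall>\<^sub>F k in sequentially. (\<integral>\<^sup>+x. ennreal ((cmod (S k x))\<^sup>2) \<partial>M) \<le> ennreal (K\<^sup>2)"
      by simp
  qed simp
  also have "\<dots> < \<infinity>" by simp
  finally show ?thesis
    by (auto simp: square_integrable_def intro!: integrableI_bounded)
qed

text \<open>\<open>Proj\<close> is a choice, so all its properties rest on this existence. The
  series of nonnegative frequencies of q is cut into blocks whose L^2-norms decay geometrically; the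
  series of blocks then converges absolutely almost everywhere, and its sum p is a concrete
  measurable function.\<close>

lemma Riesz_projection_exists:
  assumes q: "L2T q"
  shows "\<exists>p. H2 p \<and> (\<forall>n\<ge>0. fcoeff p n = fcoeff q n)"
proof -
  define c where "c n = (\<integral>t. q (circ t) * cnj (circ t ^ n) \<partial>UI)" for n
  have sq: "square_integrable UI (\<lambda>t. q (circ t))" using q by (simp add: L2T_iff)
  define K where "K = l2 UI (\<lambda>t. q (circ t))"
  have bessel: "(\<Sum>n\<in>A. (cmod (c n))\<^sup>2) \<le> K\<^sup>2" if "finite A" for A
    unfolding c_def K_def by (rule Bessel_inequality[OF sq that])
  have sc: "summable (\<lambda>n. (cmod (c n))\<^sup>2)"
    by (rule summableI_nonneg_bounded[where x="K\<^sup>2"]) (auto intro: bessel)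
  \<comment> \<open>These are squared norms: the bound (1/4)^k becomes (1/2)^k for the norm of a
    block.\<close>
  have "\<exists>N. \<forall>n\<ge>N. norm (\<Sum>i. (cmod (c (i + n)))\<^sup>2) < (1/4) ^ k" for k
    by (rule suminf_exist_split[OF _ sc]) simp
  then obtain N where N: "\<And>k n. n \<ge> N k \<Longrightarrow> norm (\<Sum>i. (cmod (c (i + n)))\<^sup>2) < (1/4) ^ k"
    by metis
  \<comment> \<open>The cut points increase strictly, and L (k + 1) exceeds N k, so the block
    starting there is bounded by the tail estimate for k.\<close>
  define L where "L k = (\<Sum>j<k. Suc (N j))" for k
  have L_Suc: "L (Suc k) = L k + Suc (N k)" "L 0 = 0" for k by (simp_all add: L_def)
  have L_ge: "L k \<ge> k" for k by (induction k) (auto simp: L_Suc)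
  define f where "f k z = (\<Sum>n\<in>{L k..<L (Suc k)}. c n * z ^ n)" for k and z :: complex
  define p where "p z = (\<Sum>k. f k z)" for z
  have psum: "(\<Sum>k<m. f k z) = (\<Sum>n<L m. c n * z ^ n)" for m z
  proof (induction m)
    case (Suc m)
    have "{..<L (Suc m)} = {..<L m} \<union> {L m..<L (Suc m)}" by (auto simp: L_Suc)
    then show ?case using Suc by (simp add: f_def sum.union_disjoint ivl_disj_int)
  qed (simp add: L_Suc)
  have sf: "square_integrable UI (\<lambda>t. f k (circ t))" for k
    unfolding f_def by simp
  have contf: "continuous_on S (f k)" for S k
    unfolding f_def by (intro continuous_intros)
  have [measurable]: "(\<lambda>t. f k (circ t)) \<in> borel_measurable borel" for k
    by (rule measurable_compose_circ[OF contf])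
  \<comment> \<open>\<open>L2T\<close> asks for measurability on the whole line and not just on
    [0,1].\<close>
  have pm: "(\<lambda>t. p (circ t)) \<in> borel_measurable borel"
    unfolding p_def by measurable
  have l2f: "l2 UI (\<lambda>t. f (Suc k) (circ t)) \<le> (1/2) ^ k" for k
  proof -
    have "(l2 UI (\<lambda>t. f (Suc k) (circ t)))\<^sup>2 = (\<Sum>n\<in>{L (Suc k)..<L (Suc (Suc k))}. (cmod (c n))\<^sup>2)"
      unfolding f_def by (rule l2_trig_sum) simp
    also have "\<dots> = (\<Sum>i<L (Suc (Suc k)) - L (Suc k). (cmod (c (i + L (Suc k))))\<^sup>2)"
      using sum.shift_bounds_nat_ivl[of "\<lambda>n. (cmod (c n))\<^sup>2" 0 "L (Suc k)" "L (Suc (Suc k)) - L (Suc k)"]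
      by (simp add: L_Suc lessThan_atLeast0 add.commute del: sum.op_ivl_Suc)
    also have "\<dots> \<le> (\<Sum>i. (cmod (c (i + L (Suc k))))\<^sup>2)"
      by (rule sum_le_suminf) (auto intro: summable_ignore_initial_segment[OF sc])
    also have "\<dots> \<le> norm (\<Sum>i. (cmod (c (i + L (Suc k))))\<^sup>2)" by simp
    also have "\<dots> < (1/4) ^ k" by (rule N) (simp add: L_Suc)
    finally have "(l2 UI (\<lambda>t. f (Suc k) (circ t)))\<^sup>2 \<le> (1/4) ^ k"
      by (rule less_imp_le)
    moreover have "(1/4) ^ k = ((1/2) ^ k :: real)\<^sup>2"
      using power_mult_distrib[of "1/2::real" "1/2" k] by (simp add: power2_eq_square)
    ultimately have "(l2 UI (\<lambda>t. f (Suc k) (circ t)))\<^sup>2 \<le> ((1/2) ^ k)\<^sup>2"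
      by (simp only:)
    then show ?thesis by (rule power2_le_imp_le) simp
  qed
  have l1f: "summable (\<lambda>k. \<integral>t. cmod (f k (circ t)) \<partial>UI)"
  proof -
    \<comment> \<open>The block with index 0 has no geometric bound, hence the shift.\<close>
    have "summable (\<lambda>k. \<integral>t. cmod (f (Suc k) (circ t)) \<partial>UI)"
    proof (rule summable_comparison_test[OF exI[of _ 0]])
      show "summable (\<lambda>k. (1/2::real) ^ k)" by (simp add: summable_geometric)
      show "\<forall>k\<ge>0. norm (\<integral>t. cmod (f (Suc k) (circ t)) \<partial>UI) \<le> (1/2) ^ k"
        using integral_norm_le_l2[OF sf] l2f by (auto intro: order_trans)
    qed
    then show ?thesis by (subst (asm) summable_Suc_iff)
  qed
  have AEs: "AE t in UI. summable (\<lambda>k. cmod (f k (circ t)))"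
    by (rule AE_summable_of_summable_integral[OF integrable_of_square_integrable[OF sf] l1f])
  \<comment> \<open>Convergence along the cut points L m suffices, because the integrals of the
    partial sums against each power of \<open>circ\<close> or its conjugate are eventually
    constant.\<close>
  have coef: "(\<lambda>m. \<integral>t. (\<Sum>n<L m. c n * circ t ^ n) * w t \<partial>UI) \<longlonglongrightarrow> (\<integral>t. p (circ t) * w t \<partial>UI)"
    if w: "square_integrable UI w" and w1: "\<And>t. cmod (w t) = 1" for w
  proof -
    have "(\<lambda>k. \<integral>t. f k (circ t) * w t \<partial>UI) sums (\<integral>t. (\<Sum>k. f k (circ t) * w t) \<partial>UI)"
    proof (rule sums_integral)
      show "integrable UI (\<lambda>t. f k (circ t) * w t)" for k
        by (rule square_integrable_mult[OF sf w])
      show "AE t in UI. summable (\<lambda>k. norm (f k (circ t) * w t))"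
        using AEs by (simp add: norm_mult w1)
      show "summable (\<lambda>k. \<integral>t. norm (f k (circ t) * w t) \<partial>UI)"
        using l1f by (simp add: norm_mult w1)
    qed
    moreover have "(\<integral>t. (\<Sum>k. f k (circ t) * w t) \<partial>UI) = (\<integral>t. p (circ t) * w t \<partial>UI)"
    proof (rule integral_cong_AE)
      have [measurable]: "w \<in> borel_measurable UI" using w by (rule square_integrable_measurable)
      have [measurable]: "(\<lambda>t. f k (circ t)) \<in> borel_measurable UI" for k
        by (rule square_integrable_measurable[OF sf])
      have [measurable]: "(\<lambda>t. p (circ t)) \<in> borel_measurable UI"
        using pm by (intro measurable_restrict_space1) simp
      show "(\<lambda>t. \<Sum>k. f k (circ t) * w t) \<in> borel_measurable UI"
        "(\<lambda>t. p (circ t) * w t) \<in> borel_measurable UI"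
        by measurable
      show "AE t in UI. (\<Sum>k. f k (circ t) * w t) = p (circ t) * w t"
        using AEs by eventually_elim (simp add: p_def suminf_mult2[OF summable_norm_cancel])
    qed
    moreover have "(\<Sum>k<m. \<integral>t. f k (circ t) * w t \<partial>UI) = (\<integral>t. (\<Sum>n<L m. c n * circ t ^ n) * w t \<partial>UI)" for m
      unfolding psum[symmetric] sum_distrib_right
      by (rule Bochner_Integration.integral_sum[symmetric]) (rule square_integrable_mult[OF sf w])
    ultimately show ?thesis by (simp add: sums_def)
  qed
  have sS: "square_integrable UI (\<lambda>t. \<Sum>n<m. c n * circ t ^ n)" for m
    by simp
  have polyS: "(\<Sum>n<m. c n * z ^ n) = poly (\<Sum>n<m. monom (c n) n) z" for m z
    by (simp add: poly_sum poly_monom)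
  have "(\<integral>t. p (circ t) * cnj (circ t ^ i) \<partial>UI) = c i" for i
  proof (rule LIMSEQ_unique[OF coef])
    show "square_integrable UI (\<lambda>t. cnj (circ t ^ i))" by (simp del: complex_cnj_power)
    have "(\<integral>t. (\<Sum>n<L m. c n * circ t ^ n) * cnj (circ t ^ i) \<partial>UI) = c i" if "m \<ge> Suc i" for m
      using that L_ge[of m] unfolding polyS integral_poly_circ_cnj
      by (simp add: coeff_sum if_distrib cong: if_cong)
    then show "(\<lambda>m. \<integral>t. (\<Sum>n<L m. c n * circ t ^ n) * cnj (circ t ^ i) \<partial>UI) \<longlonglongrightarrow> c i"
      by (intro tendsto_eventually eventually_sequentiallyI[of "Suc i"])
  qed (simp add: norm_power)
  then have nonneg: "fcoeff p (int i) = fcoeff q (int i)" for i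
    by (simp only: fcoeff_of_nat c_def)
  have neg: "(\<integral>t. p (circ t) * circ t ^ Suc i \<partial>UI) = 0" for i
  proof (rule LIMSEQ_unique[OF coef])
    show "square_integrable UI (\<lambda>t. circ t ^ Suc i)" by (rule square_integrable_circ_power)
    have "(\<integral>t. (\<Sum>n<L m. c n * circ t ^ n) * circ t ^ Suc i \<partial>UI) = 0" for m
    proof -
      have "(\<integral>t. (\<Sum>n<L m. c n * circ t ^ n) * circ t ^ Suc i \<partial>UI)
        = (\<integral>t. poly ((\<Sum>n<L m. monom (c n) n) * monom 1 (Suc i)) (circ t) \<partial>UI)"
        unfolding polyS by (simp add: poly_monom)
      then show ?thesis unfolding integral_poly_circ by (simp add: poly_monom)
    qed
    then show "(\<lambda>m. \<integral>t. (\<Sum>n<L m. c n * circ t ^ n) * circ t ^ Suc i \<partial>UI) \<longlonglongrightarrow> 0"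
      by simp
  qed (simp add: norm_power norm_mult)
  \<comment> \<open>Almost everywhere convergence and the uniform Bessel bound K on the partial sums
    allow Fatou's lemma.\<close>
  have "square_integrable UI (\<lambda>t. p (circ t))"
  proof (rule square_integrable_Fatou[where S="\<lambda>m t. \<Sum>n<L m. c n * circ t ^ n" and K=K])
    show "(\<lambda>t. p (circ t)) \<in> borel_measurable UI"
      using pm by (intro measurable_restrict_space1) simp
    show "l2 UI (\<lambda>t. \<Sum>n<L m. c n * circ t ^ n) \<le> K" for m
    proof (rule power2_le_imp_le)
      show "(l2 UI (\<lambda>t. \<Sum>n<L m. c n * circ t ^ n))\<^sup>2 \<le> K\<^sup>2"
        by (simp add: l2_trig_sum bessel)
    qed (simp add: K_def)
    show "AE t in UI. (\<lambda>m. \<Sum>n<L m. c n * circ t ^ n) \<longlonglongrightarrow> p (circ t)"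
      using AEs unfolding psum[symmetric] p_def
      by eventually_elim (auto intro!: summable_LIMSEQ summable_norm_cancel)
  qed (auto intro: square_integrable_measurable)
  then have "H2 p"
    unfolding H2_iff L2T_iff using pm neg by simp
  moreover have "fcoeff p n = fcoeff q n" if "n \<ge> 0" for n
    using nonneg[of "nat n"] that by simp
  ultimately show ?thesis by blast
qed

lemma
  assumes "L2T q"
  shows H2_Proj: "H2 (Proj q)" and fcoeff_Proj: "0 \<le> n \<Longrightarrow> fcoeff (Proj q) n = fcoeff q n"
  using someI_ex[OF Riesz_projection_exists[OF assms]] by (auto simp: Proj_def)

text \<open>\<open>Proj q\<close> and q have the same coefficients at nonnegative frequencies, so
  their difference is orthogonal to the powers of \<open>circ\<close> and hence to all their limits.
  This is how each projection in the iterates is removed.\<close>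

lemma integral_Proj:
  assumes q: "L2T q" and b: "poly_limit b"
  shows "(\<integral>t. Proj q (circ t) * cnj (b t) \<partial>UI) = (\<integral>t. q (circ t) * cnj (b t) \<partial>UI)"
proof -
  have sq: "square_integrable UI (\<lambda>t. q (circ t))" using q by (simp add: L2T_iff)
  have sp: "square_integrable UI (\<lambda>t. Proj q (circ t))"
    using H2_Proj[OF q] by (simp add: H2_def L2T_iff)
  have sb: "square_integrable UI (\<lambda>t. cnj (b t))" using b by (simp add: poly_limit_def)
  have "(\<integral>t. (Proj q (circ t) - q (circ t)) * cnj (b t) \<partial>UI) = 0"
  proof (rule poly_limit_orthogonal[OF b])
    show "square_integrable UI (\<lambda>t. Proj q (circ t) - q (circ t))"
      by (intro square_integrable_diff sp sq)
    fix n
    have sn: "square_integrable UI (\<lambda>t. cnj (circ t ^ n))" by (simp del: complex_cnj_power)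
    have "(\<integral>t. (Proj q (circ t) - q (circ t)) * cnj (circ t ^ n) \<partial>UI)
        = fcoeff (Proj q) (int n) - fcoeff q (int n)"
      unfolding fcoeff_of_nat left_diff_distrib
      by (intro Bochner_Integration.integral_diff square_integrable_mult sp sq sn)
    then show "(\<integral>t. (Proj q (circ t) - q (circ t)) * cnj (circ t ^ n) \<partial>UI) = 0"
      using fcoeff_Proj[OF q, of "int n"] by simp
  qed
  then show ?thesis
    unfolding left_diff_distrib
    by (subst (asm) Bochner_Integration.integral_diff) (auto intro: square_integrable_mult sp sq sb)
qed

section \<open>Test functions\<close>

text \<open>The entire functions \<open>exp P\<close> replace the outer function with boundary modulus \<open>exp \<phi>\<close>, so
that no boundary values of Herglotz integrals are needed.\<close>
lemma poly_outer_approx: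
  fixes \<phi> :: "real \<Rightarrow> real"
  assumes int: "integrable UI \<phi>" and neg: "AE t in UI. \<phi> t \<le> 0" and \<delta>: "0 < \<delta>"
  obtains P where "\<And>z. cmod z = 1 \<Longrightarrow> Re (poly P z) \<le> 0" "Im (poly P 0) = 0"
    "(\<integral>t. \<phi> t \<partial>UI) - \<delta> \<le> Re (poly P 0)"
    "integrable UI (\<lambda>t. \<phi> t - Re (poly P (circ t)))"
    "(\<integral>t. \<bar>\<phi> t - Re (poly P (circ t))\<bar> \<partial>UI) \<le> \<delta>"
proof -
  have [measurable]: "\<phi> \<in> borel_measurable UI" using int by auto
  \<comment> \<open>\<open>trig_approx_real\<close> wants a bounded function; by integrability a cut
    at -M costs little in L^1. M is taken positive so that the interval from -M to 0 is not a
    point.\<close>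
  have "(\<lambda>M. \<integral>t. \<bar>\<phi> t - max (\<phi> t) (- real M)\<bar> \<partial>UI) \<longlonglongrightarrow> (\<integral>t. 0 \<partial>UI)"
  proof (rule integral_dominated_convergence[where w="\<lambda>t. \<bar>\<phi> t\<bar>"])
    show "integrable UI (\<lambda>t. \<bar>\<phi> t\<bar>)" using int by simp
    show "AE t in UI. (\<lambda>M. \<bar>\<phi> t - max (\<phi> t) (- real M)\<bar>) \<longlonglongrightarrow> 0"
    proof (rule AE_I2, rule tendsto_eventually)
      fix t
      have "eventually (\<lambda>M. - \<phi> t \<le> real M) sequentially"
        using filterlim_real_sequentially by (simp add: filterlim_at_top)
      then show "eventually (\<lambda>M. \<bar>\<phi> t - max (\<phi> t) (- real M)\<bar> = 0) sequentially"
        by eventually_elim auto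
    qed
    show "AE t in UI. norm \<bar>\<phi> t - max (\<phi> t) (- real M)\<bar> \<le> \<bar>\<phi> t\<bar>" for M
      using neg by eventually_elim auto
  qed measurable
  then have "eventually (\<lambda>M. (\<integral>t. \<bar>\<phi> t - max (\<phi> t) (- real M)\<bar> \<partial>UI) < \<delta> / 2) sequentially"
    using \<delta> by (intro order_tendstoD) auto
  with eventually_gt_at_top[of 0]
  have "eventually (\<lambda>M. 0 < M \<and> (\<integral>t. \<bar>\<phi> t - max (\<phi> t) (- real M)\<bar> \<partial>UI) < \<delta> / 2) sequentially"
    by eventually_elim simp
  then obtain M where M: "0 < M" "(\<integral>t. \<bar>\<phi> t - max (\<phi> t) (- real M)\<bar> \<partial>UI) < \<delta> / 2"
    by (auto simp: eventually_sequentially)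
  define \<psi> where "\<psi> t = max (\<phi> t) (- real M)" for t
  have [measurable]: "\<psi> \<in> borel_measurable UI" unfolding \<psi>_def by measurable
  have "AE t in UI. - real M \<le> \<psi> t \<and> \<psi> t \<le> 0"
    using neg by eventually_elim (auto simp: \<psi>_def)
  then obtain Q where Q: "\<And>z. cmod z = 1 \<Longrightarrow> - real M \<le> Re (poly Q z) \<and> Re (poly Q z) \<le> 0"
    and QI: "(\<integral>t. \<bar>\<psi> t - Re (poly Q (circ t))\<bar> \<partial>UI) \<le> \<delta> / 2"
    using trig_approx_real[of \<psi> "- real M" 0 "\<delta> / 2"] M \<delta> by auto
  \<comment> \<open>Subtracting an imaginary constant leaves Re P unchanged and makes exp(P(0)) a
    positive real number.\<close>
  define P where "P = Q - [:\<i> * of_real (Im (poly Q 0)):]"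
  have ReP: "Re (poly P z) = Re (poly Q z)" for z by (simp add: P_def)
  have iP: "integrable UI (\<lambda>t. poly P (circ t))"
    by (rule integrable_circ) (intro continuous_intros)
  have iPR: "integrable UI (\<lambda>t. Re (poly P (circ t)))"
    using iP by simp
  have i\<psi>: "integrable UI \<psi>"
    unfolding \<psi>_def using int by (intro integrable_max) auto
  have i: "integrable UI (\<lambda>t. \<phi> t - Re (poly P (circ t)))"
    using int iPR by simp
  have "(\<integral>t. \<bar>\<phi> t - Re (poly P (circ t))\<bar> \<partial>UI) \<le> (\<integral>t. \<bar>\<phi> t - \<psi> t\<bar> + \<bar>\<psi> t - Re (poly P (circ t))\<bar> \<partial>UI)"
    using int iPR i\<psi> by (intro integral_mono) auto
  also have "\<dots> = (\<integral>t. \<bar>\<phi> t - \<psi> t\<bar> \<partial>UI) + (\<integral>t. \<bar>\<psi> t - Re (poly P (circ t))\<bar> \<partial>UI)"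
    using int iPR i\<psi> by (intro Bochner_Integration.integral_add) auto
  also have "\<dots> \<le> \<delta>"
    using M QI unfolding ReP \<psi>_def by simp
  finally have le: "(\<integral>t. \<bar>\<phi> t - Re (poly P (circ t))\<bar> \<partial>UI) \<le> \<delta>" .
  have "Re (poly P 0) = (\<integral>t. Re (poly P (circ t)) \<partial>UI)"
    using iP by (simp add: integral_poly_circ)
  moreover have "(\<integral>t. \<phi> t \<partial>UI) - (\<integral>t. Re (poly P (circ t)) \<partial>UI) = (\<integral>t. \<phi> t - Re (poly P (circ t)) \<partial>UI)"
    using int iPR by simp
  moreover have "\<dots> \<le> (\<integral>t. \<bar>\<phi> t - Re (poly P (circ t))\<bar> \<partial>UI)"
    using i by (intro integral_mono) auto
  ultimately have "(\<integral>t. \<phi> t \<partial>UI) - \<delta> \<le> Re (poly P 0)"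
    using le by linarith
  moreover have "Im (poly P 0) = 0" by (simp add: P_def)
  ultimately show ?thesis
    using Q le i by (intro that[of P]) (auto simp: ReP)
qed

text \<open>For |w| <= 1 one has |w - 1|^2 <= 2 - 2 Re w. With w = exp P the mean of w is exp(P(0))
  by the mean value property, and 1 - e^x <= -x finishes the estimate.\<close>

lemma l2_exp_poly_minus_1:
  assumes P: "\<And>z. cmod z = 1 \<Longrightarrow> Re (poly P z) \<le> 0" and P0: "Im (poly P 0) = 0"
  shows "(l2 UI (\<lambda>t. exp (poly P (circ t)) - 1))\<^sup>2 \<le> - 2 * Re (poly P 0)"
proof -
  have iE: "integrable UI (\<lambda>t. exp (poly P (circ t)))"
    by (rule integrable_circ) (intro continuous_intros)
  have "(l2 UI (\<lambda>t. exp (poly P (circ t)) - 1))\<^sup>2 \<le> (\<integral>t. 2 - 2 * Re (exp (poly P (circ t))) \<partial>UI)"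
    unfolding l2_power2
  proof (rule integral_mono)
    have "square_integrable UI (\<lambda>t. exp (poly P (circ t)) - 1)"
      by (rule square_integrable_circ) (intro continuous_intros)
    then show "integrable UI (\<lambda>t. (cmod (exp (poly P (circ t)) - 1))\<^sup>2)"
      by (simp add: square_integrable_def)
    show "integrable UI (\<lambda>t. 2 - 2 * Re (exp (poly P (circ t))))"
      using integrable_Re[OF iE] by (intro Bochner_Integration.integrable_diff integrable_mult_right) auto
    fix t
    define w where "w = exp (poly P (circ t))"
    have "cmod w \<le> 1" using P[of "circ t"] by (simp add: w_def)
    then have "(Re w)\<^sup>2 + (Im w)\<^sup>2 \<le> 1"
      using power_mono[of "cmod w" 1 2] by (simp add: cmod_power2)
    then show "(cmod (exp (poly P (circ t)) - 1))\<^sup>2 \<le> 2 - 2 * Re (exp (poly P (circ t)))"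
      unfolding w_def[symmetric] cmod_power2 by (simp add: power2_diff)
  qed
  also have "\<dots> = 2 - 2 * Re (\<integral>t. exp (poly P (circ t)) \<partial>UI)"
    using integrable_Re[OF iE] integral_Re[OF iE] UI.prob_space
    by (subst Bochner_Integration.integral_diff) (auto simp del: Re_exp)
  also have "(\<integral>t. exp (poly P (circ t)) \<partial>UI) = exp (poly P 0)"
    by (rule integral_holomorphic_circ[of _ 2]) (auto intro!: holomorphic_intros)
  also have "Re (exp (poly P 0)) = exp (Re (poly P 0))"
    using P0 by (simp add: Re_exp)
  also have "2 - 2 * exp (Re (poly P 0)) \<le> - 2 * Re (poly P 0)"
    using exp_ge_add_one_self[of "Re (poly P 0)"] by linarith
  finally show ?thesis .
qed

text \<open>(1 - y)^n <= e^(-ny), and s <= e^s for s = ny/m gives s^m <= e^(ny). The exponentials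
  cancel and leave (m/n)^m.\<close>

lemma power_mult_one_minus_power_le:
  fixes y :: real
  assumes y: "0 \<le> y" "y \<le> 1" and n: "0 < n" and m: "0 < m"
  shows "(1 - y) ^ n * y ^ m \<le> (real m / real n) ^ m"
proof -
  have "(1 - y) ^ n \<le> exp (- y) ^ n"
    using y exp_ge_add_one_self[of "- y"] by (intro power_mono) auto
  also have "\<dots> = exp (- (real n * y))"
    by (simp add: exp_of_nat_mult[symmetric])
  finally have 1: "(1 - y) ^ n \<le> exp (- (real n * y))" .
  have "real n * y / real m \<le> exp (real n * y / real m)"
    using exp_ge_add_one_self[of "real n * y / real m"] by linarith
  then have "(real n * y / real m) ^ m \<le> exp (real n * y / real m) ^ m"
    using y by (intro power_mono) auto
  also have "\<dots> = exp (real n * y)"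
    using m by (simp add: exp_of_nat_mult[symmetric])
  finally have 2: "(real n * y / real m) ^ m \<le> exp (real n * y)" .
  have "y ^ m = (real n * y / real m) ^ m * (real m / real n) ^ m"
    using n m by (simp flip: power_mult_distrib)
  then have "(1 - y) ^ n * y ^ m = ((1 - y) ^ n * (real n * y / real m) ^ m) * (real m / real n) ^ m"
    by simp
  also have "\<dots> \<le> (exp (- (real n * y)) * exp (real n * y)) * (real m / real n) ^ m"
    using 1 2 y by (intro mult_right_mono mult_mono) auto
  finally show ?thesis by (simp flip: exp_add)
qed

lemma abs_exp_diff_le:
  fixes a b :: real
  assumes "a \<le> 0" "b \<le> 0"
  shows "\<bar>exp a - exp b\<bar> \<le> \<bar>a - b\<bar>"
proof -
  have *: "exp x - exp y \<le> x - y" if "y \<le> x" "x \<le> 0" for x y :: real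
  proof -
    have "exp x - exp y = exp x * (1 - exp (y - x))"
      by (simp add: right_diff_distrib flip: exp_add)
    also have "1 - exp (y - x) \<le> x - y"
      using exp_ge_add_one_self[of "y - x"] by linarith
    then have "exp x * (1 - exp (y - x)) \<le> 1 * (x - y)"
      using that by (intro mult_mono) auto
    finally show ?thesis by simp
  qed
  show ?thesis
    using *[of a b] *[of b a] assms by (cases "a \<le> b") auto
qed

text \<open>For L >= 0 the truncations are dominated by |w|, and they tend to 0 pointwise as L
  grows. This is where integrability of the logarithm enters.\<close>

lemma truncated_log_integral:
  fixes w :: "real \<Rightarrow> real"
  assumes int: "integrable UI w" and \<eta>: "0 < \<eta>"
  obtains L where "integrable UI (\<lambda>t. min 0 (L + w t))" "- \<eta> \<le> (\<integral>t. min 0 (L + w t) \<partial>UI)"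
proof -
  have [measurable]: "w \<in> borel_measurable UI" using int by auto
  have i: "integrable UI (\<lambda>t. min 0 (L + w t))" for L
    using int by (intro integrable_min) auto
  have "(\<lambda>n. \<integral>t. min 0 (real n + w t) \<partial>UI) \<longlonglongrightarrow> (\<integral>t. 0 \<partial>UI)"
  proof (rule integral_dominated_convergence[where w="\<lambda>t. \<bar>w t\<bar>"])
    show "integrable UI (\<lambda>t. \<bar>w t\<bar>)" using int by simp
    show "AE t in UI. (\<lambda>n. min 0 (real n + w t)) \<longlonglongrightarrow> 0"
    proof (rule AE_I2, rule tendsto_eventually)
      fix t
      have "eventually (\<lambda>n. - w t \<le> real n) sequentially"
        using filterlim_real_sequentially by (simp add: filterlim_at_top)
      then show "eventually (\<lambda>n. min 0 (real n + w t) = 0) sequentially"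
        by eventually_elim auto
    qed
    show "AE t in UI. norm (min 0 (real n + w t)) \<le> \<bar>w t\<bar>" for n
      by (rule AE_I2) auto
  qed measurable
  then have "eventually (\<lambda>n. (\<integral>t. min 0 (real n + w t) \<partial>UI) > - \<eta>) sequentially"
    using \<eta> by (intro order_tendstoD) auto
  then obtain n where "(\<integral>t. min 0 (real n + w t) \<partial>UI) > - \<eta>"
    by (auto simp: eventually_sequentially)
  then show ?thesis using i by (intro that[of "real n"]) auto
qed

text \<open>Write x = |b|^(-n), y = 1 - 1/|b| and p = Re P. The squared modulus is (x e^\<phi>)^2 +
  x^2 (e^(2p) - e^(2\<phi>)). The first term is bounded by means of \<phi> <= L + m ln y, the second
  by 2 |\<phi> - p|, because x <= 1 and exp is 1-Lipschitz on the nonpositive reals.\<close>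

lemma l2_inverse_power_exp_le:
  fixes b :: "real \<Rightarrow> complex"
  assumes [measurable]: "b \<in> borel_measurable UI" and b1: "AE t in UI. 1 < cmod (b t)"
    and P: "\<And>z. cmod z = 1 \<Longrightarrow> Re (poly P z) \<le> 0"
    and iP: "integrable UI (\<lambda>t. min 0 (L + real m * ln (1 - 1 / cmod (b t))) - Re (poly P (circ t)))"
    and \<delta>: "(\<integral>t. \<bar>min 0 (L + real m * ln (1 - 1 / cmod (b t))) - Re (poly P (circ t))\<bar> \<partial>UI) \<le> \<delta>"
    and n: "0 < n" and m: "0 < m"
  shows "(l2 UI (\<lambda>t. inverse (b t) ^ n * (circ t ^ j * exp (poly P (circ t)))))\<^sup>2
    \<le> (exp L * (real m / real n) ^ m)\<^sup>2 + 2 * \<delta>"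
proof -
  define \<phi> where "\<phi> t = min 0 (L + real m * ln (1 - 1 / cmod (b t)))" for t
  define E where "E = exp L * (real m / real n) ^ m"
  have "(l2 UI (\<lambda>t. inverse (b t) ^ n * (circ t ^ j * exp (poly P (circ t)))))\<^sup>2
      \<le> (\<integral>t. E\<^sup>2 + 2 * \<bar>\<phi> t - Re (poly P (circ t))\<bar> \<partial>UI)"
    unfolding l2_power2
  proof (rule integral_mono_AE')
    show "integrable UI (\<lambda>t. E\<^sup>2 + 2 * \<bar>\<phi> t - Re (poly P (circ t))\<bar>)"
      using iP by (simp add: \<phi>_def)
    show "AE t in UI. 0 \<le> E\<^sup>2 + 2 * \<bar>\<phi> t - Re (poly P (circ t))\<bar>"
      by simp
    show "AE t in UI. (cmod (inverse (b t) ^ n * (circ t ^ j * exp (poly P (circ t)))))\<^sup>2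
        \<le> E\<^sup>2 + 2 * \<bar>\<phi> t - Re (poly P (circ t))\<bar>"
      using b1
    proof eventually_elim
      case (elim t)
      define y where "y = 1 - 1 / cmod (b t)"
      have y: "0 < y" "y \<le> 1" using elim by (auto simp: y_def divide_less_eq_1)
      define x where "x = (1 - y) ^ n"
      have x: "0 \<le> x" "x \<le> 1" using y by (auto simp: x_def power_le_one)
      have inv: "inverse (cmod (b t)) ^ n = x"
        by (simp add: x_def y_def inverse_eq_divide)
      define p where "p = Re (poly P (circ t))"
      have p: "p \<le> 0" using P[of "circ t"] by (simp add: p_def)
      have \<phi>0: "\<phi> t \<le> 0" by (simp add: \<phi>_def)
      have "exp (\<phi> t) \<le> exp (L + real m * ln y)"
        by (simp add: \<phi>_def y_def)
      also have "\<dots> = exp L * y ^ m"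
        using y by (simp add: exp_add exp_of_nat_mult)
      finally have "x * exp (\<phi> t) \<le> x * (exp L * y ^ m)"
        using x by (intro mult_left_mono)
      also have "\<dots> = exp L * (x * y ^ m)" by simp
      also have "\<dots> \<le> E"
        unfolding E_def x_def using y n m
        by (intro mult_left_mono power_mult_one_minus_power_le) auto
      finally have "(x * exp (\<phi> t))\<^sup>2 \<le> E\<^sup>2"
        using x by (intro power_mono) auto
      moreover have "x\<^sup>2 * (exp (2 * p) - exp (2 * \<phi> t)) \<le> 2 * \<bar>\<phi> t - p\<bar>"
      proof -
        have "x\<^sup>2 * (exp (2 * p) - exp (2 * \<phi> t)) \<le> x\<^sup>2 * \<bar>exp (2 * p) - exp (2 * \<phi> t)\<bar>"
          by (intro mult_left_mono) auto
        also have "\<dots> \<le> 1 * \<bar>2 * p - 2 * \<phi> t\<bar>"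
          using x p \<phi>0 by (intro mult_mono abs_exp_diff_le) (auto simp: power_le_one)
        also have "\<dots> = 2 * \<bar>\<phi> t - p\<bar>" by (simp add: abs_if)
        finally show ?thesis .
      qed
      moreover have "(cmod (inverse (b t) ^ n * (circ t ^ j * exp (poly P (circ t)))))\<^sup>2
          = (x * exp (\<phi> t))\<^sup>2 + x\<^sup>2 * (exp (2 * p) - exp (2 * \<phi> t))"
        by (simp add: norm_mult norm_power norm_inverse inv p_def[symmetric] power_mult_distrib
            exp_double right_diff_distrib)
      ultimately show ?case unfolding p_def by linarith
    qed
  qed
  also have "\<dots> = E\<^sup>2 + 2 * (\<integral>t. \<bar>\<phi> t - Re (poly P (circ t))\<bar> \<partial>UI)"
    using iP UI.prob_space by (simp add: \<phi>_def)
  also have "\<dots> \<le> E\<^sup>2 + 2 * \<delta>"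
    using \<delta> by (simp add: \<phi>_def)
  finally show ?thesis by (simp add: E_def)
qed

section \<open>Iterates of the adjoint Toeplitz operator\<close>

lemma L2T_cnj_mult:
  assumes g: "Hinf g" and f: "L2T f"
  shows "L2T (\<lambda>z. cnj (g z) * f z)"
proof -
  obtain C where C: "AE t in UI. cmod (g (circ t)) \<le> C"
    using g unfolding Hinf_def AE_UI by blast
  have gm: "(\<lambda>t. g (circ t)) \<in> borel_measurable lborel" and sg: "square_integrable UI (\<lambda>t. g (circ t))"
    and fm: "(\<lambda>t. f (circ t)) \<in> borel_measurable lborel" and sf: "square_integrable UI (\<lambda>t. f (circ t))"
    using g f by (auto simp: Hinf_def H2_def L2T_iff)
  have "(\<lambda>t. cnj (g (circ t))) \<in> borel_measurable lborel"
    using measurable_compose[OF gm borel_measurable_continuous_onI[of cnj]] by simp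
  then have "(\<lambda>t. cnj (g (circ t)) * f (circ t)) \<in> borel_measurable lborel"
    using fm by measurable
  moreover have "square_integrable UI (\<lambda>t. cnj (g (circ t)) * f (circ t))"
    by (rule square_integrable_bounded_mult[OF sf, where C=C])
       (use sg C in \<open>auto intro: square_integrable_measurable\<close>)
  ultimately show ?thesis by (simp add: L2T_iff)
qed

lemma H2_Toeplitz_adj_pow:
  assumes "Hinf g" "H2 f"
  shows "H2 ((Toeplitz_adj g ^^ n) f)"
proof (induction n)
  case (Suc n)
  then have "L2T ((Toeplitz_adj g ^^ n) f)" by (simp add: H2_def)
  from H2_Proj[OF L2T_cnj_mult[OF assms(1) this]] show ?case
    by (simp add: Toeplitz_adj_def[of g "(Toeplitz_adj g ^^ n) f"])
qed (simp add: assms)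

text \<open>In each step the projection is dropped because the test function is a limit of
  polynomials; then conj(g) cancels one of the factors conj(1/g).\<close>

lemma integral_Toeplitz_adj_pow:
  assumes g: "Hinf g" and G1: "\<And>z. cmod z < 1 \<Longrightarrow> 1 \<le> cmod (disc_ext g z)"
    and g1: "AE t in UI. 1 \<le> cmod (g (circ t))"
    and f: "H2 f" and F: "F holomorphic_on UNIV"
  shows "(\<integral>t. (Toeplitz_adj g ^^ n) f (circ t) * cnj (inverse (g (circ t)) ^ n * F (circ t)) \<partial>UI)
       = (\<integral>t. f (circ t) * cnj (F (circ t)) \<partial>UI)"
proof (induction n)
  case (Suc n)
  define fn where "fn = (Toeplitz_adj g ^^ n) f"
  have fn: "L2T fn" using H2_Toeplitz_adj_pow[OF g f, of n] by (simp add: fn_def H2_def)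
  obtain C where C: "AE t in UI. cmod (g (circ t)) \<le> C"
    using g unfolding Hinf_def AE_UI by blast
  have sg: "square_integrable UI (\<lambda>t. g (circ t))"
    using g by (simp add: Hinf_def H2_def L2T_iff)
  have "poly_limit (\<lambda>t. g (circ t))"
    by (rule poly_limit_of_bounded_analytic[OF square_integrable_measurable[OF sg] C])
       (use g in \<open>simp add: Hinf_def H2_iff del: power_Suc\<close>)
  then have pl: "poly_limit (\<lambda>t. inverse (g (circ t)) ^ k * F (circ t))" for k
    using g1 _ G1 F by (rule poly_limit_inverse_power) (simp only: disc_ext_def fcoeff_of_nat)
  have "(\<integral>t. (Toeplitz_adj g ^^ Suc n) f (circ t) * cnj (inverse (g (circ t)) ^ Suc n * F (circ t)) \<partial>UI)
      = (\<integral>t. (cnj (g (circ t)) * fn (circ t)) * cnj (inverse (g (circ t)) ^ Suc n * F (circ t)) \<partial>UI)"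
    using integral_Proj[OF L2T_cnj_mult[OF g fn] pl[of "Suc n"]]
    by (simp add: Toeplitz_adj_def fn_def[symmetric] del: power_Suc)
  also have "\<dots> = (\<integral>t. fn (circ t) * cnj (inverse (g (circ t)) ^ n * F (circ t)) \<partial>UI)"
  proof (rule integral_cong_AE)
    have sfn: "square_integrable UI (\<lambda>t. fn (circ t))"
      and sgfn: "square_integrable UI (\<lambda>t. cnj (g (circ t)) * fn (circ t))"
      using fn L2T_cnj_mult[OF g fn] by (auto simp: L2T_iff)
    have s: "square_integrable UI (\<lambda>t. cnj (inverse (g (circ t)) ^ k * F (circ t)))" for k
      unfolding square_integrable_cnj using pl[of k] by (simp add: poly_limit_def)
    show "(\<lambda>t. cnj (g (circ t)) * fn (circ t) * cnj (inverse (g (circ t)) ^ Suc n * F (circ t))) \<in> borel_measurable UI"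
      by (rule borel_measurable_integrable[OF square_integrable_mult[OF sgfn s]])
    show "(\<lambda>t. fn (circ t) * cnj (inverse (g (circ t)) ^ n * F (circ t))) \<in> borel_measurable UI"
      by (rule borel_measurable_integrable[OF square_integrable_mult[OF sfn s]])
    show "AE t in UI. cnj (g (circ t)) * fn (circ t) * cnj (inverse (g (circ t)) ^ Suc n * F (circ t))
        = fn (circ t) * cnj (inverse (g (circ t)) ^ n * F (circ t))"
      using g1
    proof eventually_elim
      case (elim t)
      then have "g (circ t) \<noteq> 0" by auto
      then show ?case by simp
    qed
  qed
  finally show ?case using Suc.IH by (simp add: fn_def)
qed simp

text \<open>The constant has to be uniform in n, so j, r, \<eta> and L are fixed first; only
  \<delta> and P depend on n.\<close>

lemma l2_Toeplitz_adj_pow_lower_bound: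
  assumes g: "Hinf g" and G1: "\<And>z. cmod z < 1 \<Longrightarrow> 1 \<le> cmod (disc_ext g z)"
    and g1: "AE t in UI. 1 < cmod (g (circ t))"
    and lg: "integrable UI (\<lambda>t. ln (cmod (g (circ t)) - 1))"
    and f: "H2 f" and f0: "\<not> (AE t in UI. f (circ t) = 0)" and m: "0 < m"
  obtains c where "0 < c" "\<And>n. 0 < n \<Longrightarrow> c * real n ^ m \<le> L2norm ((Toeplitz_adj g ^^ n) f)"
proof -
  define b where "b t = g (circ t)" for t
  have sb: "square_integrable UI b"
    using g by (simp add: b_def[abs_def] Hinf_def H2_def L2T_iff)
  have bm [measurable]: "b \<in> borel_measurable UI" using sb by (rule square_integrable_measurable)
  have b1: "AE t in UI. 1 < cmod (b t)" using g1 by (simp add: b_def)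
  have g1': "AE t in UI. 1 \<le> cmod (g (circ t))"
    using g1 by eventually_elim simp
  obtain C where C: "AE t in UI. cmod (b t) \<le> C"
    using g unfolding Hinf_def AE_UI b_def by blast
  have sf: "square_integrable UI (\<lambda>t. f (circ t))"
    using f by (simp add: H2_def L2T_iff)

  \<comment> \<open>The coefficients at negative frequencies vanish because f is in
    \<open>H2\<close>; if the others did too, f would vanish almost everywhere.\<close>
  have "\<exists>j. (\<integral>t. f (circ t) * cnj (circ t ^ j) \<partial>UI) \<noteq> 0"
  proof (rule ccontr)
    assume "\<not> ?thesis"
    then have z: "(\<integral>t. f (circ t) * cnj (circ t ^ j) \<partial>UI) = 0" for j by blast
    have "(\<integral>t. f (circ t) * circ t ^ j \<partial>UI) = 0" for j
      using z[of 0] f by (cases j) (auto simp: H2_iff simp del: power_Suc)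
    then show False using fourier_uniqueness[OF sf z] f0 by blast
  qed
  then obtain j where j: "(\<integral>t. f (circ t) * cnj (circ t ^ j) \<partial>UI) \<noteq> 0" ..
  define a where "a = cmod (\<integral>t. f (circ t) * cnj (circ t ^ j) \<partial>UI)"
  have a: "a > 0" using j by (simp add: a_def del: complex_cnj_power)
  define K where "K = l2 UI (\<lambda>t. f (circ t))"
  have K: "K \<ge> 0" by (simp add: K_def)
  \<comment> \<open>The target is ||F - z^j|| <= 2 r for the test function F, which changes <f, F>
    by at most (K + 1) 2 r = a/2. As -2 Re P(0) <= 2 (\<eta> + \<delta>) <= 4 \<eta>, this requires
    \<eta> = r^2.\<close>
  define r where "r = a / (4 * (K + 1))"
  have r: "r > 0" using a K by (simp add: r_def)
  define \<eta> where "\<eta> = r\<^sup>2"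
  have \<eta>: "\<eta> > 0" using r by (simp add: \<eta>_def)

  \<comment> \<open>The function is ln(|b| - 1) - ln |b|, and ln |b| is bounded since 1 < |b| <=
    C.\<close>
  have "integrable UI (\<lambda>t. ln (1 - 1 / cmod (b t)))"
  proof -
    have "integrable UI (\<lambda>t. ln (cmod (b t)))"
    proof (rule UI.integrable_const_bound)
      show "AE t in UI. norm (ln (cmod (b t))) \<le> ln C"
        using b1 C by eventually_elim (simp, subst ln_le_cancel_iff, auto)
    qed measurable
    then have "integrable UI (\<lambda>t. ln (cmod (b t) - 1) - ln (cmod (b t)))"
      using lg by (simp add: b_def)
    moreover have "AE t in UI. ln (cmod (b t) - 1) - ln (cmod (b t)) = ln (1 - 1 / cmod (b t))"
      using b1
    proof eventually_elim
      case (elim t)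
      then have nz: "b t \<noteq> 0" by auto
      then have "1 - 1 / cmod (b t) = (cmod (b t) - 1) / cmod (b t)"
        by (simp add: diff_divide_distrib)
      then show ?case using elim nz by (simp add: ln_div)
    qed
    ultimately show ?thesis
      by (subst (asm) integrable_cong_AE) auto
  qed
  then have "integrable UI (\<lambda>t. real m * ln (1 - 1 / cmod (b t)))"
    by simp
  then obtain L where i\<phi>: "integrable UI (\<lambda>t. min 0 (L + real m * ln (1 - 1 / cmod (b t))))"
    and \<phi>\<eta>: "- \<eta> \<le> (\<integral>t. min 0 (L + real m * ln (1 - 1 / cmod (b t))) \<partial>UI)"
    using truncated_log_integral[OF _ \<eta>] by blast
  \<comment> \<open>This is a / (4 E) without its factor n^m: a/2 bounds the pairing from below and
    2 E bounds the norm of the test function.\<close>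
  define c where "c = a / (4 * exp L * real m ^ m)"
  have "c > 0" using a m by (simp add: c_def)
  moreover have "c * real n ^ m \<le> L2norm ((Toeplitz_adj g ^^ n) f)" if n: "0 < n" for n
  proof -
    define E where "E = exp L * (real m / real n) ^ m"
    have E: "E > 0" using n m by (simp add: E_def)
    \<comment> \<open>\<delta> <= \<eta> keeps P(0) close to 0; \<delta> <= E^2 gives E^2 + 2
      \<delta> <= 4 E^2, so the approximation error does not spoil the decay in n.\<close>
    define \<delta> where "\<delta> = min \<eta> (E\<^sup>2)"
    have \<delta>: "\<delta> > 0" "\<delta> \<le> \<eta>" "\<delta> \<le> E\<^sup>2" using \<eta> E by (auto simp: \<delta>_def)
    obtain P where P: "\<And>z. cmod z = 1 \<Longrightarrow> Re (poly P z) \<le> 0" "Im (poly P 0) = 0"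
      and P0: "(\<integral>t. min 0 (L + real m * ln (1 - 1 / cmod (b t))) \<partial>UI) - \<delta> \<le> Re (poly P 0)"
      and iP: "integrable UI (\<lambda>t. min 0 (L + real m * ln (1 - 1 / cmod (b t))) - Re (poly P (circ t)))"
      and PI: "(\<integral>t. \<bar>min 0 (L + real m * ln (1 - 1 / cmod (b t))) - Re (poly P (circ t))\<bar> \<partial>UI) \<le> \<delta>"
      using poly_outer_approx[OF i\<phi> _ \<delta>(1)] by auto
    define F where "F z = z ^ j * exp (poly P z)" for z
    have F: "F holomorphic_on UNIV"
      unfolding F_def by (intro holomorphic_intros)
    have contF: "continuous_on (sphere 0 1) F"
      unfolding F_def by (intro continuous_intros)
    have sF: "square_integrable UI (\<lambda>t. F (circ t))"
      by (rule square_integrable_circ[OF contF])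
    have sFd: "square_integrable UI (\<lambda>t. F (circ t) - circ t ^ j)"
      by (intro square_integrable_diff sF) simp

    have "l2 UI (\<lambda>t. F (circ t) - circ t ^ j) = l2 UI (\<lambda>t. exp (poly P (circ t)) - 1)"
    proof -
      have "cmod (F (circ t) - circ t ^ j) = cmod (exp (poly P (circ t)) - 1)" for t
      proof -
        have "F (circ t) - circ t ^ j = circ t ^ j * (exp (poly P (circ t)) - 1)"
          by (simp add: F_def algebra_simps)
        then show ?thesis by (simp add: norm_mult norm_power)
      qed
      then show ?thesis by (simp add: l2_def)
    qed
    then have "(l2 UI (\<lambda>t. F (circ t) - circ t ^ j))\<^sup>2 \<le> - 2 * Re (poly P 0)"
      using l2_exp_poly_minus_1[OF P] by simp
    also have "\<dots> \<le> 4 * \<eta>"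
      using P0 \<phi>\<eta> \<delta> by linarith
    also have "\<dots> = (2 * r)\<^sup>2"
      by (simp add: \<eta>_def power_mult_distrib)
    finally have Fd: "l2 UI (\<lambda>t. F (circ t) - circ t ^ j) \<le> 2 * r"
      by (rule power2_le_imp_le) (use r in simp)

    have "(\<integral>t. f (circ t) * cnj (F (circ t)) \<partial>UI)
        = (\<integral>t. f (circ t) * cnj (circ t ^ j) + f (circ t) * cnj (F (circ t) - circ t ^ j) \<partial>UI)"
      by (simp add: algebra_simps)
    also have "\<dots> = (\<integral>t. f (circ t) * cnj (circ t ^ j) \<partial>UI) + (\<integral>t. f (circ t) * cnj (F (circ t) - circ t ^ j) \<partial>UI)"
    proof (intro Bochner_Integration.integral_add square_integrable_mult sf)
      show "square_integrable UI (\<lambda>t. cnj (circ t ^ j))"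
        "square_integrable UI (\<lambda>t. cnj (F (circ t) - circ t ^ j))"
        unfolding square_integrable_cnj using sFd by simp_all
    qed
    finally have split: "(\<integral>t. f (circ t) * cnj (F (circ t)) \<partial>UI)
        = (\<integral>t. f (circ t) * cnj (circ t ^ j) \<partial>UI) + (\<integral>t. f (circ t) * cnj (F (circ t) - circ t ^ j) \<partial>UI)" .
    have "cmod (\<integral>t. f (circ t) * cnj (F (circ t) - circ t ^ j) \<partial>UI)
        \<le> K * l2 UI (\<lambda>t. cnj (F (circ t) - circ t ^ j))"
      unfolding K_def by (rule l2_Cauchy_Schwarz[OF sf]) (simp only: square_integrable_cnj sFd)
    also have "\<dots> = K * l2 UI (\<lambda>t. F (circ t) - circ t ^ j)"
      by (simp only: l2_cnj)
    also have "\<dots> \<le> (K + 1) * (2 * r)"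
      using Fd K r by (intro mult_mono) auto
    also have "\<dots> = a / 2" using K by (simp add: r_def field_simps)
    finally have "a / 2 \<le> cmod (\<integral>t. f (circ t) * cnj (F (circ t)) \<partial>UI)"
      unfolding split using norm_diff_ineq[of "\<integral>t. f (circ t) * cnj (circ t ^ j) \<partial>UI"
        "\<integral>t. f (circ t) * cnj (F (circ t) - circ t ^ j) \<partial>UI"]
      by (simp add: a_def del: complex_cnj_power complex_cnj_diff)
    also have "(\<integral>t. f (circ t) * cnj (F (circ t)) \<partial>UI)
        = (\<integral>t. (Toeplitz_adj g ^^ n) f (circ t) * cnj (inverse (g (circ t)) ^ n * F (circ t)) \<partial>UI)"
      by (rule integral_Toeplitz_adj_pow[OF g G1 g1' f F, symmetric])
    also have "cmod \<dots> \<le> l2 UI (\<lambda>t. (Toeplitz_adj g ^^ n) f (circ t)) * l2 UI (\<lambda>t. cnj (inverse (g (circ t)) ^ n * F (circ t)))"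
    proof (rule l2_Cauchy_Schwarz)
      show "square_integrable UI (\<lambda>t. (Toeplitz_adj g ^^ n) f (circ t))"
        using H2_Toeplitz_adj_pow[OF g f, of n] by (simp add: H2_def L2T_iff)
      have [measurable]: "(\<lambda>t. g (circ t)) \<in> borel_measurable UI"
        using bm by (simp add: b_def[abs_def])
      have "square_integrable UI (\<lambda>t. inverse (g (circ t)) ^ n * F (circ t))"
      proof (rule square_integrable_bounded_mult[OF sF, where C=1])
        show "AE t in UI. cmod (inverse (g (circ t)) ^ n) \<le> 1"
          using g1' by eventually_elim (simp add: norm_power norm_inverse inverse_le_1_iff power_le_one)
      qed measurable
      then show "square_integrable UI (\<lambda>t. cnj (inverse (g (circ t)) ^ n * F (circ t)))"
        by (simp only: square_integrable_cnj)
    qed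
    also have "\<dots> = L2norm ((Toeplitz_adj g ^^ n) f) * l2 UI (\<lambda>t. inverse (b t) ^ n * (circ t ^ j * exp (poly P (circ t))))"
      unfolding L2norm_eq_l2 l2_cnj b_def F_def ..
    also have "\<dots> \<le> L2norm ((Toeplitz_adj g ^^ n) f) * (2 * E)"
    proof (rule mult_left_mono)
      have "(l2 UI (\<lambda>t. inverse (b t) ^ n * (circ t ^ j * exp (poly P (circ t)))))\<^sup>2 \<le> E\<^sup>2 + 2 * \<delta>"
        unfolding E_def by (rule l2_inverse_power_exp_le[OF bm b1 P(1) iP PI n m])
      also have "\<dots> \<le> 4 * E\<^sup>2"
        using \<delta>(3) zero_le_power2[of E] by linarith
      also have "\<dots> = (2 * E)\<^sup>2" by (simp add: power_mult_distrib)
      finally show "l2 UI (\<lambda>t. inverse (b t) ^ n * (circ t ^ j * exp (poly P (circ t)))) \<le> 2 * E"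
        by (rule power2_le_imp_le) (use E in simp)
    qed (simp add: L2norm_eq_l2)
    finally have "a / (4 * E) \<le> L2norm ((Toeplitz_adj g ^^ n) f)"
      using E by (simp add: field_simps)
    moreover have "a / (4 * E) = c * real n ^ m"
      by (simp add: c_def E_def power_divide)
    ultimately show ?thesis by simp
  qed
  ultimately show ?thesis by (rule that)
qed

theorem theorem6p2:
  fixes g f :: "complex \<Rightarrow> complex" and k :: real
  assumes "Hinf g"
    and "\<forall>z. cmod z < 1 \<longrightarrow> cmod (disc_ext g z) \<ge> 1"
    and "AE t in lborel. t \<in> {0..1} \<longrightarrow> cmod (g (circ t)) > 1"
    and "set_integrable lborel {0..1} (\<lambda>t. ln (cmod (g (circ t)) - 1))"
    and "k > 0"
    and "H2 f"
    and "\<not> (AE t in lborel. t \<in> {0..1} \<longrightarrow> f (circ t) = 0)"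
  shows "filterlim (\<lambda>n. real n powr (- k) * L2norm ((Toeplitz_adj g ^^ n) f)) at_top sequentially"
proof -
  \<comment> \<open>m >= k + 1 leaves a full power of n after multiplication by n^(-k), so the
    sequence dominates c n.\<close>
  define m where "m = Suc (nat \<lceil>k\<rceil>)"
  have m: "0 < m" "k + 1 \<le> real m" by (auto simp: m_def) linarith
  obtain c where c: "0 < c" "\<And>n. 0 < n \<Longrightarrow> c * real n ^ m \<le> L2norm ((Toeplitz_adj g ^^ n) f)"
    using l2_Toeplitz_adj_pow_lower_bound[of g f m] assms m(1)
    unfolding AE_UI[symmetric] set_integrable_UI by blast
  have "filterlim (\<lambda>n. c * real n) at_top sequentially"
    by (rule filterlim_tendsto_pos_mult_at_top[OF tendsto_const c(1) filterlim_real_sequentially])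
  then show ?thesis
  proof (rule filterlim_at_top_mono)
    show "\<forall>\<^sub>F n in sequentially. c * real n \<le> real n powr (- k) * L2norm ((Toeplitz_adj g ^^ n) f)"
      using eventually_gt_at_top[of 0]
    proof eventually_elim
      case (elim n)
      have "real n = real n powr 1" using elim by simp
      also have "\<dots> \<le> real n powr (real m - k)"
        using elim m by (intro powr_mono) auto
      also have "\<dots> = real n powr (- k) * real n ^ m"
        using elim by (simp add: powr_diff powr_minus powr_realpow field_simps)
      finally have "c * real n \<le> c * (real n powr (- k) * real n ^ m)"
        using c(1) by (intro mult_left_mono) auto
      also have "\<dots> = real n powr (- k) * (c * real n ^ m)" by simp
      also have "\<dots> \<le> real n powr (- k) * L2norm ((Toeplitz_adj g ^^ n) f)"
        using c(2)[OF elim] by (intro mult_left_mono) auto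
      finally show ?case .
    qed
  qed
qed

end
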